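(* Let $k\leq n$ be positive integers, let $\lambda\vdash n$, $\mu\vdash k$ with $\mu\subset\lambda$, and let $F:D_\lambda\to[n]$ be a Young tableau with $F^{-1}([k])=D_\mu$. Let $\mathcal{G}$ be the set of Young tableaux $G:D_\lambda\to[n]$ such that (1) $G^{-1}(i)\preceq F^{-1}(i)$ for all $i\in[k]$, with $G^{-1}(i)\prec F^{-1}(i)$ for at least one $i\in[k]$; and (2) $G^{-1}([k])=D_\delta$ for some partition $\delta\subset\lambda$. Writing $F_0=F|_{D_\mu}$, we have in the generic tensor algebra \[[F]\in\mathscr{I}([F_0])+\mathscr{I}([G]:G\in\mathcal{G}).\] In particular, writing $G_0$ for the restriction of $G$ to $G^{-1}([k])$, \[[F]\in\mathscr{I}([F_0])+\mathscr{I}([G_0]:G\in\mathcal{G}).\]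
   Context: $\mathbb{K}$ is a field of characteristic zero; $[n]=\{1,\dots,n\}$; permutations are multiplied by composition. A Young tableau of shape $\lambda\vdash n$ with entries in a set $A$ is a bijection $T:D_\lambda\to A$ where $D_\lambda=\{(i,j):1\leq j\leq\lambda_i\}$; rows $R_i(T)$, columns $C_j(T)$. For a set $X$, $\mathfrak{a}(X)=\sum_{\sigma\in\mathfrak{S}_X}\sigma$, $\mathfrak{b}(X)=\sum_{\tau\in\mathfrak{S}_X}\mathrm{sgn}(\tau)\tau$, and $\mathfrak{c}_\lambda(T)=\prod_i\mathfrak{a}(R_i(T))\cdot\prod_j\mathfrak{b}(C_j(T))\in\mathbb{K}[\mathfrak{S}_A]$. The generic tensor algebra $\mathscr{T}$ assigns to each finite set $A$ with $|A|=m$ the vector space $\mathscr{T}_A$ with basis the symbols $z_\alpha$, $\alpha:[m]\to A$ a bijection (thought of as $z_{\alpha(1)}\otimes\cdots\otimes z_{\alpha(m)}$); a bijection $\phi:A\to A'$ induces $\mathscr{T}_A\to\mathscr{T}_{A'}$, $z_\alpha\mapsto z_{\phi\circ\alpha}$ (so $\mathbb{K}[\mathfrak{S}_A]$ acts on $\mathscr{T}_A$). For disjoint $A,B$ with $|A|=r$, $|B|=s$, the product $\mathscr{T}_A\otimes\mathscr{T}_B\to\mathscr{T}_{A\sqcup B}$ is $z_\alpha\cdot z_\beta=z_\gamma$ with $\gamma(i)=\alpha(i)$ for $i\leq r$, $\gamma(i)=\beta(i-r)$ for $r<i\leq r+s$, extended bilinearly. An ideal is a family of subspaces $\mathscr{I}_A\subseteq\mathscr{T}_A$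 preserved by all maps induced by bijections and with $\mathscr{I}_A\cdot\mathscr{T}_B\subseteq\mathscr{I}_{A\sqcup B}$; the ideal generated by a set of elements is the smallest ideal containing them, and sums of ideals are taken componentwise. For a Young tableau $F:D_\lambda\to[n]$, the Young tabloid $[F]$ is the collection of elements $t_F(A,T)=\mathfrak{c}_\lambda(T)\cdot z_{T\circ F^{-1}}\in\mathscr{T}_A$ for all sets $A$ with $|A|=n$ and all Young tableaux $T:D_\lambda\to A$, and $\mathscr{I}([F])$ (resp. $\mathscr{I}([G]:G\in\mathcal{G})$) is the ideal generated by all these elements (resp. for all $G\in\mathcal{G}$). For boxes, $(x_1,y_1)\preceq(x_2,y_2)$ means $y_1\leq y_2$ and $(x_1,y_1)\prec(x_2,y_2)$ means $y_1<y_2$ (comparison of column indices). *)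

theory Defs
  imports Complex_Main "HOL-Library.FuncSet" "HOL-Library.Poly_Mapping" "HOL-Combinatorics.Permutations"
begin

section \<open>Free vector spaces\<close>

text \<open>The vector space with basis \<open>'b\<close> is the type of finitely supported functions
  \<open>'b \<Rightarrow>\<^sub>0 'k\<close>, a basis vector being \<open>Poly_Mapping.single b 1\<close>.\<close>

definition pm_scale :: "'k::field \<Rightarrow> ('b \<Rightarrow>\<^sub>0 'k) \<Rightarrow> ('b \<Rightarrow>\<^sub>0 'k)" where
  "pm_scale c x = Poly_Mapping.map ((*) c) x"

lemma lookup_pm_scale [simp]: "Poly_Mapping.lookup (pm_scale c x) b = c * Poly_Mapping.lookup x b"
  by (auto simp: pm_scale_def Poly_Mapping.map.rep_eq when_def)

global_interpretation tensor: vector_space pm_scale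
  by unfold_locales (auto intro!: poly_mapping_eqI simp: lookup_add algebra_simps)

definition lin_extend :: "('b \<Rightarrow> ('c \<Rightarrow>\<^sub>0 'k)) \<Rightarrow> ('b \<Rightarrow>\<^sub>0 'k) \<Rightarrow> ('c \<Rightarrow>\<^sub>0 'k::field)" where
  "lin_extend f x = (\<Sum>b\<in>Poly_Mapping.keys x. pm_scale (Poly_Mapping.lookup x b) (f b))"

section \<open>Group algebra of the symmetric group\<close>

text \<open>Permutations of \<open>X \<subseteq> A\<close> are functions on the whole type fixing everything outside \<open>X\<close>,
  so the inclusion of the symmetric group on \<open>X\<close> into the one on \<open>A\<close> is the identity.\<close>

type_synonym ('a, 'k) group_algebra = "('a \<Rightarrow> 'a) \<Rightarrow>\<^sub>0 'k"

definition ga_one :: "('a, 'k::field) group_algebra" where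
  "ga_one = Poly_Mapping.single id 1"

definition ga_mult ::
  "('a, 'k::field) group_algebra \<Rightarrow> ('a, 'k) group_algebra \<Rightarrow> ('a, 'k) group_algebra" where
  "ga_mult f g = lin_extend (\<lambda>p. lin_extend (\<lambda>q. Poly_Mapping.single (p \<circ> q) 1) g) f"

definition ga_prod_list :: "('a, 'k::field) group_algebra list \<Rightarrow> ('a, 'k) group_algebra" where
  "ga_prod_list fs = foldr ga_mult fs ga_one"

definition symmetrizer :: "'a set \<Rightarrow> ('a, 'k::field) group_algebra" where
  "symmetrizer X = (\<Sum>\<sigma> | \<sigma> permutes X. Poly_Mapping.single \<sigma> 1)"

definition antisymmetrizer :: "'a set \<Rightarrow> ('a, 'k::field) group_algebra" where
  "antisymmetrizer X = (\<Sum>\<tau> | \<tau> permutes X. Poly_Mapping.single \<tau> (of_int (sign \<tau>)))"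

section \<open>Partitions and Young tableaux\<close>

text \<open>A partition is the list of its positive parts in weakly decreasing order.\<close>

definition is_partition :: "nat list \<Rightarrow> bool" where
  "is_partition lam \<longleftrightarrow> sorted_wrt (\<ge>) lam \<and> 0 \<notin> set lam"

definition partition_of :: "nat list \<Rightarrow> nat \<Rightarrow> bool" where
  "partition_of lam n \<longleftrightarrow> is_partition lam \<and> sum_list lam = n"

definition part :: "nat list \<Rightarrow> nat \<Rightarrow> nat" where
  "part lam i = (if 1 \<le> i \<and> i \<le> length lam then lam ! (i - 1) else 0)"

definition diagram :: "nat list \<Rightarrow> (nat \<times> nat) set" where
  "diagram lam = {(i, j). 1 \<le> i \<and> 1 \<le> j \<and> j \<le> part lam i}"

text \<open>Bijections \<open>X \<rightarrow> Y\<close> are made extensional, so that each one is a single HOL function.\<close>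

definition bijections :: "'b set \<Rightarrow> 'c set \<Rightarrow> ('b \<Rightarrow> 'c) set" where
  "bijections X Y = {f \<in> X \<rightarrow>\<^sub>E Y. bij_betw f X Y}"

abbreviation tableaux :: "nat list \<Rightarrow> 'a set \<Rightarrow> (nat \<times> nat \<Rightarrow> 'a) set" where
  "tableaux lam A \<equiv> bijections (diagram lam) A"

definition tab_row :: "nat list \<Rightarrow> (nat \<times> nat \<Rightarrow> 'a) \<Rightarrow> nat \<Rightarrow> 'a set" where
  "tab_row lam T i = T ` {b \<in> diagram lam. fst b = i}"

definition tab_col :: "nat list \<Rightarrow> (nat \<times> nat \<Rightarrow> 'a) \<Rightarrow> nat \<Rightarrow> 'a set" where
  "tab_col lam T j = T ` {b \<in> diagram lam. snd b = j}"

definition young_symmetrizer ::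
  "nat list \<Rightarrow> (nat \<times> nat \<Rightarrow> 'a) \<Rightarrow> ('a, 'k::field) group_algebra" where
  "young_symmetrizer lam T =
     ga_mult
       (ga_prod_list (map (\<lambda>i. symmetrizer (tab_row lam T i)) [1..<length lam + 1]))
       (ga_prod_list (map (\<lambda>j. antisymmetrizer (tab_col lam T j)) [1..<part lam 1 + 1]))"

definition box_le :: "nat \<times> nat \<Rightarrow> nat \<times> nat \<Rightarrow> bool" (infix "\<preceq>" 50) where
  "b \<preceq> c \<longleftrightarrow> snd b \<le> snd c"

definition box_less :: "nat \<times> nat \<Rightarrow> nat \<times> nat \<Rightarrow> bool" (infix "\<prec>" 50) where
  "b \<prec> c \<longleftrightarrow> snd b < snd c"

section \<open>The generic tensor algebra\<close>

text \<open>The finite sets indexing the algebra are the finite subsets of a type \<open>'a\<close>.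
  The symbol \<open>z\<^sub>\<alpha>\<close> is \<open>Poly_Mapping.single \<alpha> 1\<close>.\<close>

type_synonym ('a, 'k) tensor = "(nat \<Rightarrow> 'a) \<Rightarrow>\<^sub>0 'k"

definition tensors :: "'a set \<Rightarrow> ('a, 'k::field) tensor set" where
  "tensors A = {x. Poly_Mapping.keys x \<subseteq> bijections {1..card A} A}"

text \<open>The map \<open>tensors A \<rightarrow> tensors A'\<close> induced by a bijection \<open>\<phi> : A \<rightarrow> A'\<close>;
  \<open>compose\<close> (from FuncSet) is the extensional composition.\<close>

definition tensor_map ::
  "'a set \<Rightarrow> ('a \<Rightarrow> 'a) \<Rightarrow> ('a, 'k::field) tensor \<Rightarrow> ('a, 'k) tensor" where
  "tensor_map A \<phi> = lin_extend (\<lambda>\<alpha>. Poly_Mapping.single (compose {1..card A} \<phi> \<alpha>) 1)"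

definition ga_act ::
  "'a set \<Rightarrow> ('a, 'k::field) group_algebra \<Rightarrow> ('a, 'k) tensor \<Rightarrow> ('a, 'k) tensor" where
  "ga_act A f x = lin_extend (\<lambda>p. tensor_map A p x) f"

definition concat_bij :: "nat \<Rightarrow> nat \<Rightarrow> (nat \<Rightarrow> 'a) \<Rightarrow> (nat \<Rightarrow> 'a) \<Rightarrow> (nat \<Rightarrow> 'a)" where
  "concat_bij r s \<alpha> \<beta> = (\<lambda>i\<in>{1..r + s}. if i \<le> r then \<alpha> i else \<beta> (i - r))"

definition tensor_mult ::
  "'a set \<Rightarrow> 'a set \<Rightarrow> ('a, 'k::field) tensor \<Rightarrow> ('a, 'k) tensor \<Rightarrow> ('a, 'k) tensor" where
  "tensor_mult A B x y =
     lin_extend (\<lambda>\<alpha>. lin_extend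
       (\<lambda>\<beta>. Poly_Mapping.single (concat_bij (card A) (card B) \<alpha> \<beta>) 1) y) x"

text \<open>Families are functions on all sets; only their values at finite sets matter.\<close>

definition is_ideal :: "('a set \<Rightarrow> ('a, 'k::field) tensor set) \<Rightarrow> bool" where
  "is_ideal I \<longleftrightarrow>
     (\<forall>A. finite A \<longrightarrow> I A \<subseteq> tensors A \<and> tensor.subspace (I A)) \<and>
     (\<forall>A A' \<phi>. finite A \<and> finite A' \<and> bij_betw \<phi> A A' \<longrightarrow> (\<forall>x\<in>I A. tensor_map A \<phi> x \<in> I A')) \<and>
     (\<forall>A B. finite A \<and> finite B \<and> A \<inter> B = {} \<longrightarrow>
        (\<forall>x\<in>I A. \<forall>y\<in>tensors B. tensor_mult A B x y \<in> I (A \<union> B)))"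

text \<open>The whole algebra is an ideal, so the intersection defining \<open>ideal_gen\<close> is not vacuous.\<close>

lemma keys_lin_extend:
  "Poly_Mapping.keys (lin_extend f x) \<subseteq> (\<Union>b\<in>Poly_Mapping.keys x. Poly_Mapping.keys (f b))"
  unfolding lin_extend_def by (rule order_trans[OF keys_sum]) (auto simp: in_keys_iff)

lemma compose_bijections:
  assumes "\<alpha> \<in> bijections {1..card A} A" "bij_betw \<phi> A A'"
  shows "compose {1..card A} \<phi> \<alpha> \<in> bijections {1..card A'} A'"
proof -
  have *: "card A = card A'" using assms(2) by (rule bij_betw_same_card)
  have "bij_betw (compose {1..card A} \<phi> \<alpha>) {1..card A} A'"
    using assms by (intro bij_betw_compose) (auto simp: bijections_def)
  then show ?thesis
    unfolding bijections_def PiE_def *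
    using bij_betwE[of "compose {1..card A} \<phi> \<alpha>" "{1..card A}" A']
    by (simp add: * Pi_iff compose_extensional)
qed

lemma concat_bijections:
  assumes "\<alpha> \<in> bijections {1..card A} A" "\<beta> \<in> bijections {1..card B} B"
    and "finite A" "finite B" "A \<inter> B = {}"
  shows "concat_bij (card A) (card B) \<alpha> \<beta> \<in> bijections {1..card (A \<union> B)} (A \<union> B)"
proof -
  let ?r = "card A" and ?s = "card B"
  let ?c = "concat_bij ?r ?s \<alpha> \<beta>"
  have "bij_betw ?c {1..?r} A"
    using assms(1) by (subst bij_betw_cong[of _ _ \<alpha>]) (auto simp: concat_bij_def bijections_def)
  moreover have "bij_betw (\<lambda>i. i - ?r) {?r + 1..?r + ?s} {1..?s}"
    by (rule bij_betwI[where g = "\<lambda>i. i + ?r"]) auto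
  then have "bij_betw (\<beta> \<circ> (\<lambda>i. i - ?r)) {?r + 1..?r + ?s} B"
    by (rule bij_betw_trans) (use assms(2) in \<open>auto simp: bijections_def\<close>)
  then have "bij_betw ?c {?r + 1..?r + ?s} B"
    by (subst bij_betw_cong[of _ _ "\<beta> \<circ> (\<lambda>i. i - ?r)"]) (auto simp: concat_bij_def)
  ultimately have "bij_betw ?c ({1..?r} \<union> {?r + 1..?r + ?s}) (A \<union> B)"
    using assms(5) by (rule bij_betw_combine)
  moreover have "{1..?r} \<union> {?r + 1..?r + ?s} = {1..card (A \<union> B)}"
    using assms(3-5) by (auto simp: card_Un_disjoint)
  ultimately have "bij_betw ?c {1..card (A \<union> B)} (A \<union> B)" by simp
  then show ?thesis
    unfolding bijections_def PiE_def
    using assms(3-5) bij_betwE[of ?c "{1..card (A \<union> B)}" "A \<union> B"]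
    by (simp add: concat_bij_def card_Un_disjoint Pi_iff)
qed

lemma is_ideal_tensors: "is_ideal (tensors :: 'a set \<Rightarrow> ('a, 'k::field) tensor set)"
  unfolding is_ideal_def
proof (intro conjI allI impI ballI; (elim conjE)?)
  show "tensor.subspace (tensors A :: ('a, 'k) tensor set)" for A :: "'a set"
  proof (rule tensor.subspaceI)
    show "0 \<in> tensors A" by (simp add: tensors_def)
  next
    fix x y :: "('a, 'k) tensor"
    assume "x \<in> tensors A" "y \<in> tensors A"
    then show "x + y \<in> tensors A"
      using Poly_Mapping.keys_add[of x y] unfolding tensors_def by blast
  next
    fix c and x :: "('a, 'k) tensor"
    assume "x \<in> tensors A"
    then show "pm_scale c x \<in> tensors A"
      by (auto simp: tensors_def in_keys_iff subset_iff)
  qed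
  show "tensors A \<subseteq> (tensors A :: ('a, 'k) tensor set)" for A :: "'a set" by (rule order_refl)
next
  fix A A' :: "'a set" and \<phi> and x :: "('a, 'k) tensor"
  assume "bij_betw \<phi> A A'" "x \<in> tensors A"
  then have "\<alpha> \<in> Poly_Mapping.keys x \<Longrightarrow>
      compose {1..card A} \<phi> \<alpha> \<in> bijections {1..card A'} A'" for \<alpha>
    by (intro compose_bijections) (auto simp: tensors_def)
  then show "tensor_map A \<phi> x \<in> tensors A'"
    unfolding tensors_def tensor_map_def mem_Collect_eq
    by (intro order_trans[OF keys_lin_extend] UN_least) simp
next
  fix A B :: "'a set" and x y :: "('a, 'k) tensor"
  assume "finite A" "finite B" "A \<inter> B = {}" "x \<in> tensors A" "y \<in> tensors B"
  then have "\<alpha> \<in> Poly_Mapping.keys x \<Longrightarrow> \<beta> \<in> Poly_Mapping.keys y \<Longrightarrow>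
      concat_bij (card A) (card B) \<alpha> \<beta> \<in> bijections {1..card (A \<union> B)} (A \<union> B)" for \<alpha> \<beta>
    by (intro concat_bijections) (auto simp: tensors_def)
  then show "tensor_mult A B x y \<in> tensors (A \<union> B)"
    unfolding tensors_def tensor_mult_def mem_Collect_eq
    by (intro order_trans[OF keys_lin_extend] UN_least) simp
qed

definition ideal_gen ::
  "('a set \<Rightarrow> ('a, 'k::field) tensor set) \<Rightarrow> ('a set \<Rightarrow> ('a, 'k) tensor set)" where
  "ideal_gen S A = \<Inter> {I A | I. is_ideal I \<and> (\<forall>B. finite B \<longrightarrow> S B \<subseteq> I B)}"

definition ideal_sum ::
  "('a set \<Rightarrow> ('a, 'k::field) tensor set) \<Rightarrow> ('a set \<Rightarrow> ('a, 'k) tensor set) \<Rightarrow>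
   ('a set \<Rightarrow> ('a, 'k) tensor set)" where
  "ideal_sum I J A = {x + y | x y. x \<in> I A \<and> y \<in> J A}"

section \<open>Young tabloids\<close>

text \<open>\<open>tabloid_elem lam F A T\<close> is \<open>t\<^sub>F(A,T)\<close>, where \<open>F : diagram lam \<rightarrow> [n]\<close> and \<open>n = card A\<close>.\<close>

definition tabloid_elem ::
  "nat list \<Rightarrow> (nat \<times> nat \<Rightarrow> nat) \<Rightarrow> 'a set \<Rightarrow> (nat \<times> nat \<Rightarrow> 'a) \<Rightarrow> ('a, 'k::field) tensor" where
  "tabloid_elem lam F A T =
     ga_act A (young_symmetrizer lam T)
       (Poly_Mapping.single (compose {1..card A} T (inv_into (diagram lam) F)) 1)"

text \<open>\<open>young_tabloid lam F A\<close> is the part of the collection \<open>[F]\<close> lying in \<open>tensors A\<close>.\<close>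

definition young_tabloid ::
  "nat list \<Rightarrow> (nat \<times> nat \<Rightarrow> nat) \<Rightarrow> 'a set \<Rightarrow> ('a, 'k::field) tensor set" where
  "young_tabloid lam F A =
     {tabloid_elem lam F A T | T. finite A \<and> card A = sum_list lam \<and> T \<in> tableaux lam A}"

end

theory Submission
  imports Defs
begin

text \<open>Write \<open>c(T)\<close> for the Young symmetrizer of \<open>T\<close>, \<open>S\<close> for the restriction of \<open>T\<close> to the
  inner diagram, and \<open>a(S)\<close>, \<open>b(S)\<close> for its row and column sums, so \<open>c(S) = a(S) b(S)\<close>.
  Multiplying \<open>c(S) z\<close> by \<open>c(T)\<close> stays in the ideal of the inner tabloid, so it suffices to show
  \<open>c(T) c(S) = b c(T) + (terms c(T) g with g moving the entries of S to the left)\<close> with \<open>b \<noteq> 0\<close>.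

  The elements \<open>c(T) g b(S)\<close> satisfy the Garnir relations and are skew in the columns of \<open>T\<close> (acting
  on places) and of \<open>S\<close> (acting on labels). Give each entry of \<open>S\<close> its column in \<open>S\<close> as a letter, and
  all other entries one large letter. Straightening, in characteristic zero, rewrites every such
  element by fillings whose letters increase strictly along rows. In such a filling the letter \<open>j\<close>
  occurs only in the first \<open>j\<close> columns, and the entries of \<open>S\<close> occupy a partition diagram.

  To see \<open>b \<noteq> 0\<close>, sum the coefficients over the row group of \<open>S\<close>. This functional kills all
  leftward terms, and on \<open>c(T) c(S)\<close> it is a positive multiple of the sum of squares of the
  coefficients of \<open>a(S) b(S) a(S)\<close>.\<close>

section \<open>Linear extension and permutations preserving a fibration\<close>

text \<open>Two vectors and their sum have different supports; a common finite index set makes their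
  extensions comparable term by term.\<close>

lemma lin_extend_superset:
  assumes "finite K" "Poly_Mapping.keys x \<subseteq> K"
  shows "lin_extend f x = (\<Sum>b\<in>K. pm_scale (Poly_Mapping.lookup x b) (f b))"
  unfolding lin_extend_def using assms
  by (intro sum.mono_neutral_left) (auto simp: in_keys_iff)

lemma lin_extend_zero [simp]: "lin_extend f 0 = 0"
  by (simp add: lin_extend_def)

lemma lin_extend_single [simp]: "lin_extend f (Poly_Mapping.single b k) = pm_scale k (f b)"
  by (subst lin_extend_superset[of "{b}"]) (auto simp: in_keys_iff lookup_single when_def)

lemma lin_extend_add: "lin_extend f (x + y) = lin_extend f x + lin_extend f y"
proof -
  let ?K = "Poly_Mapping.keys x \<union> Poly_Mapping.keys y"
  have "lin_extend f z = (\<Sum>b\<in>?K. pm_scale (Poly_Mapping.lookup z b) (f b))"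
    if "z \<in> {x, y, x + y}" for z
    using that keys_add[of x y] by (intro lin_extend_superset) auto
  then show ?thesis
    by (simp add: lookup_add tensor.scale_left_distrib sum.distrib)
qed

lemma lin_extend_scale: "lin_extend f (pm_scale k x) = pm_scale k (lin_extend f x)"
  by (subst (1 2) lin_extend_superset[of "Poly_Mapping.keys x"])
     (auto simp: in_keys_iff tensor.scale_sum_right)

lemma lin_extend_sum: "lin_extend f (sum g I) = (\<Sum>i\<in>I. lin_extend f (g i))"
  by (induction I rule: infinite_finite_induct) (auto simp: lin_extend_add)

lemma lin_extend_in_subspace:
  assumes "x \<in> tensor.span S" "tensor.subspace J" "\<And>s. s \<in> S \<Longrightarrow> lin_extend f s \<in> J"
  shows "lin_extend f x \<in> J"
  using assms(1)
proof (induction rule: tensor.span_induct_alt)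
  case base
  then show ?case using assms(2) by (simp add: tensor.subspace_0)
next
  case (step c a y)
  then show ?case
    using assms(2,3) by (simp add: lin_extend_add lin_extend_scale tensor.subspace_add tensor.subspace_scale)
qed

lemma pm_scale_single [simp]:
  "pm_scale a (Poly_Mapping.single b k) = Poly_Mapping.single b (a * k)"
  by (rule poly_mapping_eqI) (simp add: lookup_single when_def)

lemma ga_mult_sum_single:
  "ga_mult (\<Sum>p\<in>P. Poly_Mapping.single p (a p)) (\<Sum>q\<in>Q. Poly_Mapping.single q (b q)) =
   (\<Sum>p\<in>P. \<Sum>q\<in>Q. Poly_Mapping.single (p \<circ> q) (a p * b q))"
  by (simp add: ga_mult_def lin_extend_sum tensor.scale_sum_right)

text \<open>With \<open>f\<close> the row or column number of an entry, this is the row or column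
  group of a tableau. Permutations act on the whole type, so the group of a subset is literally a
  subgroup.\<close>

definition fiber_perms :: "('a \<Rightarrow> 'b) \<Rightarrow> 'a set \<Rightarrow> ('a \<Rightarrow> 'a) set" where
  "fiber_perms f A = {p. p permutes A \<and> (\<forall>a\<in>A. f (p a) = f a)}"

lemma finite_fiber_perms [simp]: "finite A \<Longrightarrow> finite (fiber_perms f A)"
  by (simp add: fiber_perms_def finite_permutations)

lemma fiber_perms_permutes: "p \<in> fiber_perms f A \<Longrightarrow> p permutes A"
  by (simp add: fiber_perms_def)

lemma fiber_perms_apply: "p \<in> fiber_perms f A \<Longrightarrow> f (p a) = f a"
  by (cases "a \<in> A") (auto simp: fiber_perms_def permutes_not_in)

lemma fiber_perms_compose:
  "p \<in> fiber_perms f A \<Longrightarrow> q \<in> fiber_perms f A \<Longrightarrow> p \<circ> q \<in> fiber_perms f A"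
  by (auto simp: fiber_perms_def permutes_compose permutes_in_image)

lemma fiber_perms_inv: "p \<in> fiber_perms f A \<Longrightarrow> inv p \<in> fiber_perms f A"
  unfolding fiber_perms_def
  by (smt (verit, best) mem_Collect_eq permutes_inv permutes_inverses(1) permutes_in_image)

lemma fiber_perms_id [simp]: "id \<in> fiber_perms f A"
  by (simp add: fiber_perms_def permutes_id)

lemma fiber_perms_subset: "B \<subseteq> A \<Longrightarrow> fiber_perms f B \<subseteq> fiber_perms f A"
  by (auto simp: fiber_perms_def intro: permutes_subset) (metis permutes_not_in)

lemma sum_fiber_perms_compose_right:
  assumes "q \<in> fiber_perms f A"
  shows "(\<Sum>p\<in>fiber_perms f A. h (p \<circ> q)) = (\<Sum>p\<in>fiber_perms f A. h p)"
proof -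
  have q: "q permutes A" using assms by (rule fiber_perms_permutes)
  have 1: "p \<circ> inv q \<circ> q = p" "p \<circ> q \<circ> inv q = p" for p
    by (simp_all add: comp_assoc permutes_inv_o[OF q])
  show ?thesis
    by (rule sum.reindex_bij_witness[of _ "\<lambda>p. p \<circ> inv q" "\<lambda>p. p \<circ> q"])
      (auto simp: 1 fiber_perms_compose fiber_perms_inv assms)
qed

lemma sum_fiber_perms_compose_left:
  assumes "q \<in> fiber_perms f A"
  shows "(\<Sum>p\<in>fiber_perms f A. h (q \<circ> p)) = (\<Sum>p\<in>fiber_perms f A. h p)"
proof -
  have q: "q permutes A" using assms by (rule fiber_perms_permutes)
  have 1: "inv q \<circ> (q \<circ> p) = p" "q \<circ> (inv q \<circ> p) = p" for p
    by (simp_all add: comp_assoc[symmetric] permutes_inv_o[OF q])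
  show ?thesis
    by (rule sum.reindex_bij_witness[of _ "\<lambda>p. inv q \<circ> p" "\<lambda>p. q \<circ> p"])
      (auto simp: 1 fiber_perms_compose fiber_perms_inv assms)
qed

lemma sum_fiber_perms_inv:
  "(\<Sum>p\<in>fiber_perms f A. h (inv p)) = (\<Sum>p\<in>fiber_perms f A. h p)"
  by (rule sum.reindex_bij_witness[of _ inv inv])
    (auto simp: fiber_perms_inv permutes_inv_inv dest!: fiber_perms_permutes)

lemma sign_compose_permutes:
  "finite A \<Longrightarrow> p permutes A \<Longrightarrow> q permutes A \<Longrightarrow> sign (p \<circ> q) = sign p * sign q"
  by (intro sign_compose permutes_imp_permutation)

lemma restrict_permutes:
  assumes "finite X" "p permutes A" "p ` X \<subseteq> X"
  shows "(\<lambda>a. if a \<in> X then p a else a) permutes X"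
proof (rule bij_imp_permutes)
  have "inj_on p X" using assms(2) by (meson inj_on_subset permutes_inj subset_UNIV)
  then have "bij_betw p X X" using assms(1,3) by (simp add: bij_betw_def endo_inj_surj)
  then show "bij_betw (\<lambda>a. if a \<in> X then p a else a) X X"
    by (subst bij_betw_cong[of _ _ p]) auto
qed auto

text \<open>A permutation preserving \<open>f\<close> splits uniquely into its action on the fibre
  over \<open>j\<close> and its action on the remaining fibres.\<close>

lemma bij_betw_fiber_perms_insert:
  fixes f :: "'a \<Rightarrow> 'b"
  assumes "finite A" "j \<notin> J"
  defines "X \<equiv> {a \<in> A. f a = j}" and "B \<equiv> {a \<in> A. f a \<in> J}"
  shows "bij_betw (\<lambda>(p, q). p \<circ> q) ({p. p permutes X} \<times> fiber_perms f B)
           (fiber_perms f {a \<in> A. f a \<in> insert j J})"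
proof -
  have XB: "{a \<in> A. f a \<in> insert j J} = X \<union> B" "X \<inter> B = {}" "finite X" "finite B"
    using assms by (auto simp: X_def B_def)
  have fX: "f a = j" if "a \<in> X" for a using that by (simp add: X_def)
  have fB: "f a \<in> J" if "a \<in> B" for a using that by (simp add: B_def)
  show ?thesis unfolding XB(1)
  proof (intro bij_betw_imageI inj_onI)
    fix x y assume x: "x \<in> {p. p permutes X} \<times> fiber_perms f B"
      and y: "y \<in> {p. p permutes X} \<times> fiber_perms f B"
      and eq: "(case x of (p, q) \<Rightarrow> p \<circ> q) = (case y of (p, q) \<Rightarrow> p \<circ> q)"
    obtain p q p' q' where xy: "x = (p, q)" "y = (p', q')" by (cases x, cases y)
    have P: "p permutes X" "p' permutes X" "q permutes B" "q' permutes B"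
      using x y xy by (auto simp: fiber_perms_def)
    have e: "p (q a) = p' (q' a)" for a using eq xy by (auto dest: fun_cong[where x = a])
    \<comment> \<open>On \<open>B\<close> the values of \<open>q\<close> and \<open>q'\<close> stay
      outside \<open>X\<close>, where the left factors are the identity.\<close>
    have "q a = q' a" for a
    proof (cases "a \<in> B")
      case True
      then have "q a \<in> B" "q' a \<in> B" using P by (auto simp: permutes_in_image)
      then have "q a \<notin> X" "q' a \<notin> X" using XB(2) by auto
      then show ?thesis using e[of a] P by (simp add: permutes_not_in)
    qed (use P in \<open>simp add: permutes_not_in\<close>)
    moreover have "p a = p' a" for a
    proof (cases "a \<in> X")
      case True
      then have "a \<notin> B" using XB(2) by auto
      then show ?thesis using e[of a] P by (simp add: permutes_not_in)
    qed (use P in \<open>simp add: permutes_not_in\<close>)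
    ultimately show "x = y" using xy by auto
  next
    show "(\<lambda>(p, q). p \<circ> q) ` ({p. p permutes X} \<times> fiber_perms f B) = fiber_perms f (X \<union> B)"
    proof (intro equalityI subsetI)
      fix z assume "z \<in> (\<lambda>(p, q). p \<circ> q) ` ({p. p permutes X} \<times> fiber_perms f B)"
      then obtain p q where z: "z = p \<circ> q" "p permutes X" "q \<in> fiber_perms f B" by auto
      have "p \<in> fiber_perms f X"
        using z(2) fX by (auto simp: fiber_perms_def permutes_in_image)
      then have "p \<in> fiber_perms f (X \<union> B)" "q \<in> fiber_perms f (X \<union> B)"
        using z(3) fiber_perms_subset[of X "X \<union> B" f] fiber_perms_subset[of B "X \<union> B" f] by auto
      then show "z \<in> fiber_perms f (X \<union> B)" by (simp add: z(1) fiber_perms_compose)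
    next
      fix z assume z: "z \<in> fiber_perms f (X \<union> B)"
      then have zp: "z permutes X \<union> B" by (rule fiber_perms_permutes)
      have zX: "z ` X \<subseteq> X"
      proof
        fix b assume "b \<in> z ` X"
        then obtain a where a: "a \<in> X" "b = z a" by auto
        then have "f b = j" using fiber_perms_apply[OF z] fX by auto
        moreover have "b \<in> X \<union> B" using a permutes_in_image[OF zp, of a] by auto
        ultimately show "b \<in> X" using fB \<open>j \<notin> J\<close> by auto
      qed
      have zB: "z ` B \<subseteq> B"
      proof
        fix b assume "b \<in> z ` B"
        then obtain a where a: "a \<in> B" "b = z a" by auto
        then have "f b \<in> J" using fiber_perms_apply[OF z] fB by auto
        moreover have "b \<in> X \<union> B" using a permutes_in_image[OF zp, of a] by auto
        ultimately show "b \<in> B" using fX \<open>j \<notin> J\<close> by auto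
      qed
      let ?p = "\<lambda>a. if a \<in> X then z a else a" and ?q = "\<lambda>a. if a \<in> B then z a else a"
      have "?p permutes X" "?q permutes B"
        using restrict_permutes[OF _ zp] zX zB XB by auto
      moreover have "\<forall>a\<in>B. f (?q a) = f a" using fiber_perms_apply[OF z] by simp
      moreover have "z = ?p \<circ> ?q"
      proof
        fix a
        show "z a = (?p \<circ> ?q) a"
          using XB(2) zB permutes_not_in[OF zp, of a] by auto
      qed
      ultimately show "z \<in> (\<lambda>(p, q). p \<circ> q) ` ({p. p permutes X} \<times> fiber_perms f B)"
        by (intro image_eqI[of _ _ "(?p, ?q)"]) (auto simp: fiber_perms_def)
    qed
  qed
qed

text \<open>By unique factorization, multiplying out the sums of the single rows or columns gives
  one sum over the whole row or column group. The character \<open>\<chi>\<close> is trivial for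
  rows and the sign for columns.\<close>

lemma ga_prod_list_fibers:
  fixes \<chi> :: "('a \<Rightarrow> 'a) \<Rightarrow> 'k::field"
  assumes "finite A" "distinct js"
    and mult: "\<And>p q. p permutes A \<Longrightarrow> q permutes A \<Longrightarrow> \<chi> (p \<circ> q) = \<chi> p * \<chi> q" and one: "\<chi> id = 1"
  shows "ga_prod_list (map (\<lambda>j. \<Sum>p | p permutes {a \<in> A. f a = j}. Poly_Mapping.single p (\<chi> p)) js) =
     (\<Sum>p\<in>fiber_perms f {a \<in> A. f a \<in> set js}. Poly_Mapping.single p (\<chi> p))"
  using \<open>distinct js\<close>
proof (induction js)
  case Nil
  have "fiber_perms f {} = {id}" by (auto simp: fiber_perms_def)
  then show ?case using one by (simp add: ga_prod_list_def ga_one_def id_def)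
next
  case (Cons j js)
  let ?X = "{a \<in> A. f a = j}" and ?B = "{a \<in> A. f a \<in> set js}"
  have A: "p permutes A" if "p permutes ?X \<or> p permutes ?B" for p
    using that by (auto intro: permutes_subset)
  have "(\<Sum>p\<in>fiber_perms f {a \<in> A. f a \<in> set (j # js)}. Poly_Mapping.single p (\<chi> p)) =
     (\<Sum>(p, q)\<in>{p. p permutes ?X} \<times> fiber_perms f ?B. Poly_Mapping.single (p \<circ> q) (\<chi> (p \<circ> q)))"
    using sum.reindex_bij_betw[OF bij_betw_fiber_perms_insert[OF \<open>finite A\<close>, of j "set js" f],
        of "\<lambda>p. Poly_Mapping.single p (\<chi> p)"] Cons.prems
    by (simp add: case_prod_unfold)
  also have "\<dots> = (\<Sum>p | p permutes ?X. \<Sum>q\<in>fiber_perms f ?B. Poly_Mapping.single (p \<circ> q) (\<chi> p * \<chi> q))"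
    unfolding sum.cartesian_product
    by (intro sum.cong) (auto simp: mult A fiber_perms_permutes)
  also have "\<dots> = ga_mult (\<Sum>p | p permutes ?X. Poly_Mapping.single p (\<chi> p))
       (\<Sum>q\<in>fiber_perms f ?B. Poly_Mapping.single q (\<chi> q))"
    by (simp add: ga_mult_sum_single)
  finally show ?case using Cons by (simp add: ga_prod_list_def)
qed

section \<open>Diagrams and Garnir relations\<close>

lemma part_le_sum_list: "part lam i \<le> sum_list lam"
  using member_le_sum_list[of "lam ! (i - 1)" lam] by (auto simp: part_def)

lemma finite_diagram [simp]: "finite (diagram lam)"
proof (rule finite_subset)
  show "diagram lam \<subseteq> {1..length lam} \<times> {1..sum_list lam}"
    using part_le_sum_list[of lam] by (fastforce simp: diagram_def part_def split: if_splits)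
qed simp

lemma part_antimono:
  assumes "is_partition lam" "1 \<le> i'" "i' \<le> i"
  shows "part lam i \<le> part lam i'"
proof -
  have "lam ! (i - 1) \<le> lam ! (i' - 1)" if "i' < i" "i \<le> length lam"
    using assms that unfolding is_partition_def by (auto intro: sorted_wrt_nth_less[of "(\<ge>)"])
  then show ?thesis using assms by (cases "i = i'") (auto simp: part_def)
qed

lemma diagram_down_closed:
  assumes "is_partition lam" "(i, j) \<in> diagram lam" "1 \<le> i'" "i' \<le> i" "1 \<le> j'" "j' \<le> j"
  shows "(i', j') \<in> diagram lam"
  using part_antimono[OF assms(1,3,4)] assms(2-) by (auto simp: diagram_def)

lemma down_closed_eq_atLeastAtMost:
  fixes N :: "nat set"
  assumes "finite N" "0 \<notin> N" "\<And>i i'. i \<in> N \<Longrightarrow> 1 \<le> i' \<Longrightarrow> i' \<le> i \<Longrightarrow> i' \<in> N"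
  shows "N = {1..card N}"
proof (cases "N = {}")
  case False
  have "N = {1..Max N}"
  proof (intro equalityI subsetI)
    fix i assume "i \<in> N"
    then show "i \<in> {1..Max N}" using assms(1,2) by (cases i) auto
  next
    fix i assume "i \<in> {1..Max N}"
    then show "i \<in> N" using assms(3)[OF Max_in[OF assms(1) False]] by auto
  qed
  then show ?thesis by (metis card_atLeastAtMost diff_Suc_1)
qed simp

text \<open>Rows and the first column of \<open>U\<close> are initial segments, so \<open>U\<close>
  is recovered from its row lengths \<open>\<rho>\<close>. Listing them only up to the height
  \<open>m\<close> of the first column excludes zero parts.\<close>

lemma ex_partition_diagram:
  assumes "finite U" and pos: "\<And>i j. (i, j) \<in> U \<Longrightarrow> 1 \<le> i \<and> 1 \<le> j"
    and dc: "\<And>i j i' j'. (i, j) \<in> U \<Longrightarrow> 1 \<le> i' \<Longrightarrow> i' \<le> i \<Longrightarrow> 1 \<le> j' \<Longrightarrow> j' \<le> j \<Longrightarrow> (i', j') \<in> U"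
  shows "\<exists>\<delta>. is_partition \<delta> \<and> diagram \<delta> = U"
proof -
  define \<rho> where "\<rho> i = card {j. (i, j) \<in> U}" for i
  have fin: "finite {j. (i, j) \<in> U}" "finite {i. (i, 1) \<in> U}" for i
  proof -
    show "finite {j. (i, j) \<in> U}"
      by (rule finite_subset[of _ "snd ` U"]) (use assms(1) in force)+
    show "finite {i. (i, 1) \<in> U}"
      by (rule finite_subset[of _ "fst ` U"]) (use assms(1) in force)+
  qed
  have row: "{j. (i, j) \<in> U} = {1..\<rho> i}" for i
    unfolding \<rho>_def
  proof (rule down_closed_eq_atLeastAtMost)
    show "0 \<notin> {j. (i, j) \<in> U}" using pos[of i 0] by auto
    show "j' \<in> {j. (i, j) \<in> U}" if "j \<in> {j. (i, j) \<in> U}" "1 \<le> j'" "j' \<le> j" for j j'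
      using that pos[of i j] dc[of i j i j'] by simp
  qed (rule fin)
  define m where "m = card {i. (i, 1) \<in> U}"
  have col: "{i. (i, 1) \<in> U} = {1..m}"
    unfolding m_def
  proof (rule down_closed_eq_atLeastAtMost)
    show "0 \<notin> {i. (i, 1) \<in> U}" using pos[of 0 1] by auto
    show "i' \<in> {i. (i, 1) \<in> U}" if "i \<in> {i. (i, 1) \<in> U}" "1 \<le> i'" "i' \<le> i" for i i'
      using that dc[of i 1 i' 1] by simp
  qed (rule fin)
  have rho_pos: "1 \<le> \<rho> i \<longleftrightarrow> 1 \<le> i \<and> i \<le> m" for i
  proof -
    have "1 \<le> \<rho> i \<longleftrightarrow> (i, 1) \<in> U" using row[of i] by (auto simp: set_eq_iff)
    also have "\<dots> \<longleftrightarrow> i \<in> {1..m}" using col by blast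
    finally show ?thesis by simp
  qed
  have anti: "\<rho> i \<le> \<rho> i'" if "1 \<le> i'" "i' \<le> i" for i i'
    unfolding \<rho>_def using that pos dc[of i _ i'] by (intro card_mono fin subsetI) auto
  define \<delta> where "\<delta> = map \<rho> [1..<Suc m]"
  have is_p: "is_partition \<delta>"
    unfolding is_partition_def \<delta>_def sorted_wrt_map
  proof (intro conjI)
    show "sorted_wrt (\<lambda>x y. \<rho> y \<le> \<rho> x) [1..<Suc m]"
      using anti by (auto simp: sorted_wrt_iff_nth_less simp del: upt_Suc)
    show "0 \<notin> set (map \<rho> [1..<Suc m])"
    proof
      assume "0 \<in> set (map \<rho> [1..<Suc m])"
      then obtain i where "\<rho> i = 0" "1 \<le> i" "i \<le> m" by fastforce
      then show False using rho_pos[of i] by simp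
    qed
  qed
  have part: "part \<delta> i = (if 1 \<le> i then \<rho> i else 0)" for i
    using rho_pos[of i] by (auto simp: part_def \<delta>_def simp del: upt_Suc)
  have "diagram \<delta> = U"
  proof (intro set_eqI, clarify)
    fix i j
    have "(i, j) \<in> U \<longleftrightarrow> j \<in> {1..\<rho> i}" using row[of i] by blast
    then show "(i, j) \<in> diagram \<delta> \<longleftrightarrow> (i, j) \<in> U"
      using part pos[of i j] by (auto simp: diagram_def)
  qed
  with is_p show ?thesis by blast
qed

text \<open>The tableau enters through the coordinates \<open>r\<close>, \<open>c\<close> of its
  entries and the inner tableau through the subset \<open>A0\<close>, so the group algebra argument
  concerns permutations of \<open>A\<close> only.\<close>

locale nested_diagrams =
  fixes lam mu :: "nat list" and A :: "'a set" and r c :: "'a \<Rightarrow> nat"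
  assumes partition: "is_partition lam" "is_partition mu"
    and sub: "diagram mu \<subseteq> diagram lam"
    and box: "bij_betw (\<lambda>a. (r a, c a)) A (diagram lam)"
begin

definition A0 :: "'a set" where "A0 = {a \<in> A. (r a, c a) \<in> diagram mu}"

abbreviation "row_group \<equiv> fiber_perms r A"
abbreviation "col_group \<equiv> fiber_perms c A"
abbreviation "row_group0 \<equiv> fiber_perms r A0"
abbreviation "col_group0 \<equiv> fiber_perms c A0"

text \<open>With \<open>r\<close>, \<open>c\<close> the row and column of an entry of \<open>T\<close>, these are \<open>c(T) g\<close> and \<open>c(T) g b(S)\<close>;
  the permutation \<open>g\<close> moves the label \<open>a\<close> to the place occupied by \<open>g a\<close> in \<open>T\<close>.\<close>

definition young_elem :: "('a \<Rightarrow> 'a) \<Rightarrow> ('a, 'k::field) group_algebra" where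
  "young_elem g = (\<Sum>p\<in>row_group. \<Sum>t\<in>col_group. Poly_Mapping.single (p \<circ> t \<circ> g) (of_int (sign t)))"

definition alt_elem :: "('a \<Rightarrow> 'a) \<Rightarrow> ('a, 'k::field) group_algebra" where
  "alt_elem g = (\<Sum>t\<in>col_group0. pm_scale (of_int (sign t)) (young_elem (g \<circ> t)))"

lemma finite_A [simp]: "finite A" and A0_subset: "A0 \<subseteq> A" and finite_A0 [simp]: "finite A0"
proof -
  show "finite A" using bij_betw_finite[OF box] by simp
  then show "A0 \<subseteq> A" "finite A0" by (auto simp: A0_def)
qed

lemma box_inj: "a \<in> A \<Longrightarrow> b \<in> A \<Longrightarrow> r a = r b \<Longrightarrow> c a = c b \<Longrightarrow> a = b"
  using bij_betw_imp_inj_on[OF box] by (auto dest: inj_onD)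

lemma box_in: "a \<in> A \<Longrightarrow> (r a, c a) \<in> diagram lam"
  using bij_betwE[OF box] by auto

lemma box_pos: "a \<in> A \<Longrightarrow> 1 \<le> r a" "a \<in> A \<Longrightarrow> 1 \<le> c a"
  using box_in[of a] by (auto simp: diagram_def)

lemma box_down:
  assumes "a \<in> A" "1 \<le> i" "i \<le> r a" "1 \<le> j" "j \<le> c a"
  obtains b where "b \<in> A" "r b = i" "c b = j"
proof -
  have "(i, j) \<in> diagram lam"
    using diagram_down_closed[OF partition(1) box_in[OF assms(1)]] assms(2-) by simp
  then have "(i, j) \<in> (\<lambda>a. (r a, c a)) ` A" by (simp add: bij_betw_imp_surj_on[OF box])
  then show ?thesis using that by auto
qed

section \<open>Skewness in columns and Garnir relations\<close>

lemma sign_mult: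
  "p permutes A \<Longrightarrow> q permutes A \<Longrightarrow> sign (p \<circ> q) = sign p * sign q"
  by (rule sign_compose_permutes[OF finite_A])

lemma sign_inv: "p permutes A \<Longrightarrow> sign (inv p) = sign p"
  by (meson finite_A permutes_imp_permutation sign_inverse)

lemma permutes_A0: "p permutes A0 \<Longrightarrow> p permutes A"
  using A0_subset by (rule permutes_subset[rotated])

text \<open>The column sum of \<open>T\<close> stands directly to the left of \<open>g\<close> and
  absorbs a column permutation of places up to its sign.\<close>

lemma young_elem_col:
  assumes t: "t \<in> col_group"
  shows "young_elem (t \<circ> g) = pm_scale (of_int (sign t) :: 'k::field) (young_elem g)"
proof -
  have "(\<Sum>s\<in>col_group. Poly_Mapping.single (p \<circ> s \<circ> (t \<circ> g)) (of_int (sign s))) =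
     (\<Sum>s\<in>col_group. Poly_Mapping.single (p \<circ> (s \<circ> t) \<circ> g) (of_int (sign t * sign (s \<circ> t)) :: 'k))" for p :: "'a \<Rightarrow> 'a"
    using t by (intro sum.cong refl) (simp add: sign_mult fiber_perms_permutes comp_assoc mult.left_commute)
  also have "\<dots> p = (\<Sum>s\<in>col_group. Poly_Mapping.single (p \<circ> s \<circ> g) (of_int (sign t * sign s)))" for p :: "'a \<Rightarrow> 'a"
    by (rule sum_fiber_perms_compose_right[OF t])
  finally show ?thesis by (simp add: young_elem_def tensor.scale_sum_right)
qed

lemma alt_elem_col:
  assumes "t \<in> col_group"
  shows "alt_elem (t \<circ> g) = pm_scale (of_int (sign t) :: 'k::field) (alt_elem g)"
  by (simp add: alt_elem_def comp_assoc young_elem_col[OF assms] tensor.scale_sum_right mult.commute)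

text \<open>Here b(S), standing to the right of \<open>g\<close>, absorbs the permutation of
  labels.\<close>

lemma alt_elem_label:
  assumes t: "t \<in> col_group0"
  shows "alt_elem (g \<circ> t) = pm_scale (of_int (sign t) :: 'k::field) (alt_elem g)"
proof -
  have "alt_elem (g \<circ> t) =
     (\<Sum>s\<in>col_group0. pm_scale (of_int (sign t * sign (t \<circ> s)) :: 'k) (young_elem (g \<circ> (t \<circ> s))))"
    unfolding alt_elem_def using t
    by (intro sum.cong refl)
      (simp add: sign_mult permutes_A0 fiber_perms_permutes comp_assoc)
  also have "\<dots> = (\<Sum>s\<in>col_group0. pm_scale (of_int (sign t * sign s)) (young_elem (g \<circ> s)))"
    by (rule sum_fiber_perms_compose_left[OF t])
  finally show ?thesis by (simp add: alt_elem_def tensor.scale_sum_right)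
qed

text \<open>If \<open>t x\<close> and \<open>t y\<close> lie in one row, then \<open>t\<close> carries the transposition of \<open>x\<close> and \<open>y\<close> to a row
  permutation, so the terms belonging to \<open>t\<close> cancel in pairs.\<close>

lemma garnir_young:
  assumes Z: "Z \<subseteq> A" and coll: "\<And>t. t \<in> col_group \<Longrightarrow> \<not> inj_on (r \<circ> t) Z"
  shows "(\<Sum>s | s permutes Z. pm_scale (of_int (sign s)) (young_elem (s \<circ> g))) =
    (0 :: ('a, 'k::field_char_0) group_algebra)"
proof -
  \<comment> \<open>The part of the relation belonging to one column permutation \<open>t\<close>;
    each such part vanishes by itself.\<close>
  define S :: "('a \<Rightarrow> 'a) \<Rightarrow> ('a, 'k) group_algebra" where
    "S t = (\<Sum>p\<in>row_group. \<Sum>s | s permutes Z.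
       Poly_Mapping.single (p \<circ> t \<circ> (s \<circ> g)) (of_int (sign t * sign s)))" for t
  have ZA: "s permutes A" if "s permutes Z" for s using that Z by (rule permutes_subset)
  have fZ: "finite Z" using Z finite_A by (rule finite_subset)
  have S0: "S t = 0" if t: "t \<in> col_group" for t
  proof -
    have tA: "t permutes A" using t by (rule fiber_perms_permutes)
    obtain x y where xy: "x \<in> Z" "y \<in> Z" "x \<noteq> y" "r (t x) = r (t y)"
      using coll[OF t] by (auto simp: inj_on_def)
    let ?u = "Transposition.transpose x y" and ?u' = "Transposition.transpose (t x) (t y)"
    have u: "?u permutes Z" using xy by (simp add: permutes_swap_id)
    have tin: "t x \<in> A" "t y \<in> A" using xy Z tA by (auto simp: permutes_in_image)
    then have u': "?u' \<in> row_group"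
      using xy(4) by (auto simp: fiber_perms_def permutes_swap_id transpose_def)
    have tu: "t \<circ> ?u = ?u' \<circ> t"
      using permutes_inj[OF tA] by (auto simp: fun_eq_iff transpose_def inj_eq)
    have sgn: "sign (?u \<circ> s) = - sign s" if "s permutes Z" for s
      using sign_mult[OF ZA[OF u] ZA[OF that]] xy(3) by (simp add: sign_swap_id)
    have "S t = (\<Sum>p\<in>row_group. \<Sum>s | s permutes Z.
       Poly_Mapping.single (p \<circ> t \<circ> ((?u \<circ> s) \<circ> g)) (of_int (sign t * sign (?u \<circ> s))))"
      unfolding S_def
      by (rule sum.cong[OF refl], rule setum_permutations_compose_left[OF u])
    also have "\<dots> = (\<Sum>p\<in>row_group. \<Sum>s | s permutes Z.
       Poly_Mapping.single ((p \<circ> ?u') \<circ> t \<circ> (s \<circ> g)) (- of_int (sign t * sign s)))"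
    proof (intro sum.cong refl, goal_cases)
      case (1 p s)
      have "p \<circ> t \<circ> ((?u \<circ> s) \<circ> g) = p \<circ> (t \<circ> ?u) \<circ> (s \<circ> g)" by (simp add: comp_assoc)
      then show ?case using 1 by (simp add: tu sgn comp_assoc)
    qed
    also have "\<dots> = (\<Sum>p\<in>row_group. \<Sum>s | s permutes Z.
       Poly_Mapping.single (p \<circ> t \<circ> (s \<circ> g)) (- of_int (sign t * sign s)))"
      by (rule sum_fiber_perms_compose_right[OF u'])
    also have "\<dots> = - S t"
      by (simp add: S_def single_uminus sum_negf)
    finally have "S t = - S t" .
    have "Poly_Mapping.lookup (S t) x = - Poly_Mapping.lookup (S t) x" for x
      by (subst (1) \<open>S t = - S t\<close>) simp
    moreover have "y = 0" if "y = - y" for y :: 'k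
    proof -
      have "2 * y = 0" using that by (metis add.right_inverse mult_2)
      then show ?thesis by simp
    qed
    ultimately have "Poly_Mapping.lookup (S t) x = 0" for x by blast
    then show ?thesis by (intro poly_mapping_eqI) simp
  qed
  have "(\<Sum>s | s permutes Z. pm_scale (of_int (sign s)) (young_elem (s \<circ> g))) =
     (\<Sum>s | s permutes Z. \<Sum>p\<in>row_group. \<Sum>t\<in>col_group.
       Poly_Mapping.single (p \<circ> t \<circ> (s \<circ> g)) (of_int (sign t * sign s)))"
    by (simp add: young_elem_def tensor.scale_sum_right mult.commute)
  also have "\<dots> = (\<Sum>p\<in>row_group. \<Sum>t\<in>col_group. \<Sum>s | s permutes Z.
       Poly_Mapping.single (p \<circ> t \<circ> (s \<circ> g)) (of_int (sign t * sign s)))"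
    by (rule trans[OF sum.swap], rule sum.cong[OF refl], rule sum.swap)
  also have "\<dots> = (\<Sum>t\<in>col_group. S t)"
    unfolding S_def by (rule sum.swap)
  also have "\<dots> = 0" by (simp add: S0)
  finally show ?thesis .
qed

text \<open>The relation acts to the left of \<open>g\<close>, so it survives right multiplication
  by b(S): every label permutation \<open>t\<close> gives the relation for
  \<open>g \<circ> t\<close>.\<close>

lemma garnir_alt:
  assumes "Z \<subseteq> A" "\<And>t. t \<in> col_group \<Longrightarrow> \<not> inj_on (r \<circ> t) Z"
  shows "(\<Sum>s | s permutes Z. pm_scale (of_int (sign s)) (alt_elem (s \<circ> g))) =
    (0 :: ('a, 'k::field_char_0) group_algebra)"
proof -
  have "(\<Sum>s | s permutes Z. pm_scale (of_int (sign s)) (alt_elem (s \<circ> g))) =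
    (\<Sum>s | s permutes Z. \<Sum>t\<in>col_group0.
      pm_scale (of_int (sign t)) (pm_scale (of_int (sign s)) (young_elem (s \<circ> (g \<circ> t)) :: ('a, 'k) group_algebra)))"
    by (simp add: alt_elem_def tensor.scale_sum_right comp_assoc mult.commute)
  also have "\<dots> = (\<Sum>t\<in>col_group0. \<Sum>s | s permutes Z.
      pm_scale (of_int (sign t)) (pm_scale (of_int (sign s)) (young_elem (s \<circ> (g \<circ> t)))))"
    by (rule sum.swap)
  also have "\<dots> = 0"
    by (simp only: tensor.scale_sum_right[symmetric] garnir_young[OF assms] tensor.scale_zero_right sum.neutral_const)
  finally show ?thesis .
qed

text \<open>Pigeonhole: every row that meets column \<open>Suc j\<close> also meets column
  \<open>j\<close>, so the entries moved by \<open>t\<close> have only as many rows available as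
  column \<open>j\<close> has boxes.\<close>

lemma not_inj_rows:
  assumes X: "X \<subseteq> {a \<in> A. c a = j}" and Y: "Y \<subseteq> {a \<in> A. c a = Suc j}" and "1 \<le> j"
    and gt: "card {a \<in> A. c a = j} < card X + card Y" and t: "t \<in> col_group"
  shows "\<not> inj_on (r \<circ> t) (X \<union> Y)"
proof
  assume inj: "inj_on (r \<circ> t) (X \<union> Y)"
  have "(r \<circ> t) ` (X \<union> Y) \<subseteq> r ` {a \<in> A. c a = j}"
  proof
    fix i assume "i \<in> (r \<circ> t) ` (X \<union> Y)"
    then obtain a where a: "a \<in> X \<union> Y" "i = r (t a)" by auto
    have ta: "t a \<in> A" "c (t a) \<in> {j, Suc j}"
      using a X Y t fiber_perms_apply[OF t] permutes_in_image[OF fiber_perms_permutes[OF t]] by auto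
    obtain b where "b \<in> A" "r b = i" "c b = j"
      by (rule box_down[OF ta(1), of i j]) (use ta a box_pos[OF ta(1)] \<open>1 \<le> j\<close> in auto)
    then show "i \<in> r ` {a \<in> A. c a = j}" by blast
  qed
  then have "card ((r \<circ> t) ` (X \<union> Y)) \<le> card (r ` {a \<in> A. c a = j})"
    by (intro card_mono) auto
  then have "card (X \<union> Y) \<le> card (r ` {a \<in> A. c a = j})"
    by (simp only: card_image[OF inj])
  also have "\<dots> \<le> card {a \<in> A. c a = j}" by (rule card_image_le) simp
  also have "card (X \<union> Y) = card X + card Y"
    using X Y by (intro card_Un_disjoint) (force intro: finite_subset[OF _ finite_A])+
  finally show False using gt by simp
qed

section \<open>Straightening\<close>

text \<open>The sum serves as a number exceeding every column index, hence every letter of an inner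
  label.\<close>

definition outer_letter :: nat where "outer_letter = Suc (sum c A)"

definition letter :: "'a \<Rightarrow> nat" where "letter s = (if s \<in> A0 then c s else outer_letter)"

text \<open>It grows when large letters move right and small letters move left, and so measures the
  progress of straightening.\<close>

definition potential :: "('a \<Rightarrow> 'a) \<Rightarrow> nat" where "potential g = (\<Sum>s\<in>A. letter s * c (g s))"

lemma c_less_outer_letter: "a \<in> A \<Longrightarrow> c a < outer_letter"
  by (simp add: outer_letter_def less_Suc_eq_le member_le_sum)

lemma letter_le_outer_letter: "a \<in> A \<Longrightarrow> letter a \<le> outer_letter"
  using c_less_outer_letter[of a] by (simp add: letter_def)

section \<open>Exchanging letters between neighbouring columns\<close>

lemma sum_c_permutes: "g permutes A \<Longrightarrow> (\<Sum>a\<in>A. f (c (g a))) = (\<Sum>a\<in>A. f (c a))"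
  by (rule sum.permute[symmetric, of g A "\<lambda>a. f (c a)", unfolded o_def])

lemma image_mset_c_permutes: "g permutes A \<Longrightarrow> image_mset (\<lambda>a. c (g a)) (mset_set A) = image_mset c (mset_set A)"
proof -
  assume g: "g permutes A"
  have "image_mset g (mset_set A) = mset_set (g ` A)"
    by (rule image_mset_mset_set) (use g in \<open>auto intro: permutes_inj_on\<close>)
  then show ?thesis
    using g by (simp add: permutes_image image_mset.compositionality[symmetric, unfolded o_def])
qed

text \<open>The left column contributes only letters at least \<open>e\<close> and the right column
  only letters at most \<open>e\<close>; hence large letters can move only right and small ones only
  left.\<close>

lemma exchange_letters:
  assumes g: "g permutes A"
    and X: "X \<subseteq> {a \<in> A. c a = j \<and> e \<le> letter (inv g a)}"
    and Y: "Y \<subseteq> {a \<in> A. c a = Suc j \<and> letter (inv g a) \<le> e}"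
    and s: "s permutes X \<union> Y" and "a \<in> A"
  shows "c (s (g a)) = c (g a) \<or> e \<le> letter a \<and> c (g a) < c (s (g a)) \<or>
     letter a \<le> e \<and> c (s (g a)) < c (g a)"
proof (cases "g a \<in> X \<union> Y")
  case True
  then have "s (g a) \<in> X \<union> Y" using permutes_in_image[OF s] by simp
  moreover have "inv g (g a) = a" using g by (simp add: permutes_inverses)
  ultimately have "c (g a) = j \<and> e \<le> letter a \<or> c (g a) = Suc j \<and> letter a \<le> e"
    "c (s (g a)) = j \<or> c (s (g a)) = Suc j"
    using True X Y by auto
  then show ?thesis by auto
qed (simp add: permutes_not_in[OF s])

text \<open>Outer labels carry a letter above \<open>e\<close>, so an exchange never moves them
  left. This invariant later forces a standard term without strict left moves to be a column
  permutation.\<close>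

lemma exchange_noncore:
  assumes "g permutes A" "X \<subseteq> {a \<in> A. c a = j \<and> e \<le> letter (inv g a)}"
    and "Y \<subseteq> {a \<in> A. c a = Suc j \<and> letter (inv g a) \<le> e}" "s permutes X \<union> Y"
    and "e < outer_letter" "a \<in> A - A0"
  shows "c (g a) \<le> c (s (g a))"
  using exchange_letters[OF assms(1-4), of a] assms(5,6) by (auto simp: letter_def)

text \<open>If the potential does not grow, then only labels with the letter \<open>e\<close> have changed their column.
  These lie in a single column of \<open>S\<close>, and skewness in that column undoes the exchange.\<close>

lemma exchange_term:
  assumes g: "g permutes A" and e: "e < outer_letter"
    and X: "X \<subseteq> {a \<in> A. c a = j \<and> e \<le> letter (inv g a)}"
    and Y: "Y \<subseteq> {a \<in> A. c a = Suc j \<and> letter (inv g a) \<le> e}"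
    and s: "s permutes X \<union> Y"
  shows "potential g < potential (s \<circ> g) \<or>
    pm_scale (of_int (sign s)) (alt_elem (s \<circ> g)) = (alt_elem g :: ('a, 'k::field_char_0) group_algebra)"
proof (rule disj_imp[THEN iffD2], rule impI)
  assume potential: "\<not> potential g < potential (s \<circ> g)"
  have sA: "s permutes A" by (rule permutes_subset[OF s]) (use X Y in auto)
  have sgA: "s \<circ> g permutes A" using sA g by (rule permutes_compose[rotated])
  \<comment> \<open>Subtracting \<open>e\<close> from all letters leaves the total change of the
    potential unaltered, because the sum of the columns is preserved, but makes every summand
    nonnegative.\<close>
  define d where "d a = (int (letter a) - int e) * (int (c (s (g a))) - int (c (g a)))" for a
  note ex = exchange_letters[OF g X Y s]
  have d0: "0 \<le> d a" if "a \<in> A" for a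
    using ex[OF that] by (auto simp: d_def zero_le_mult_iff)
  have "(\<Sum>a\<in>A. int (c (s (g a)))) = (\<Sum>a\<in>A. int (c (g a)))"
    using sum_c_permutes[OF g, of int] sum_c_permutes[OF sgA, of int] by simp
  then have "(\<Sum>a\<in>A. d a) = int (potential (s \<circ> g)) - int (potential g)"
    by (simp add: d_def potential_def algebra_simps sum.distrib sum_subtractf flip: sum_distrib_left)
  then have "(\<Sum>a\<in>A. d a) \<le> 0" using potential by simp
  then have "(\<Sum>a\<in>A. d a) = 0" using d0 by (simp add: order_antisym sum_nonneg)
  then have dz: "d a = 0" if "a \<in> A" for a
    using d0 that sum_nonneg_eq_0_iff[of A d] by auto
  \<comment> \<open>By \<open>dz\<close> only labels with letter \<open>e\<close> can have changed
    column; as \<open>e\<close> is below \<open>outer_letter\<close>, they are entries of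
    \<open>S\<close> in its column \<open>e\<close>.\<close>
  define K where "K = {a \<in> A0. c a = e}"
  have KA: "K \<subseteq> A" using A0_subset by (auto simp: K_def)
  have out: "c (s (g a)) = c (g a)" if "a \<in> A - K" for a
    using dz[of a] that e by (auto simp: d_def K_def letter_def split: if_splits)
  \<comment> \<open>After cancelling the unchanged labels, \<open>K\<close> occupies the same
    multiset of columns before and after the exchange, so some permutation \<open>t\<close> of
    \<open>K\<close> restores the column of each label.\<close>
  have "image_mset (\<lambda>a. c (g a)) (mset_set A) = image_mset (\<lambda>a. c (s (g a))) (mset_set A)"
    using image_mset_c_permutes[OF g] image_mset_c_permutes[OF sgA] by simp
  moreover have "mset_set A = mset_set K + mset_set (A - K)"
    using KA by (subst mset_set_Union[symmetric]) (auto intro: finite_subset simp: Un_absorb1)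
  moreover have "image_mset (\<lambda>a. c (g a)) (mset_set (A - K)) = image_mset (\<lambda>a. c (s (g a))) (mset_set (A - K))"
    using out by (intro image_mset_cong) auto
  ultimately have "image_mset (\<lambda>a. c (g a)) (mset_set K) = image_mset (\<lambda>a. c (s (g a))) (mset_set K)"
    by simp
  then obtain t where t: "t permutes K" "\<forall>a\<in>K. c (g a) = c (s (g (t a)))"
    by (rule image_mset_eq_implies_permutes[OF finite_subset[OF KA finite_A]])
  have t0: "t \<in> col_group0"
  proof -
    have "c (t a) = c a" for a
      using permutes_in_image[OF t(1), of a] permutes_not_in[OF t(1), of a]
      by (cases "a \<in> K") (auto simp: K_def)
    moreover have "t permutes A0" using t(1) by (rule permutes_subset) (auto simp: K_def)
    ultimately show ?thesis by (simp add: fiber_perms_def)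
  qed
  have tA: "t permutes A" using t0 by (intro permutes_A0 fiber_perms_permutes)
  have all: "c (s (g (t a))) = c (g a)" if "a \<in> A" for a
    using t out[of a] that by (cases "a \<in> K") (auto simp: permutes_not_in)
  \<comment> \<open>Chosen so that \<open>\<kappa> \<circ> g = s \<circ> g \<circ> t\<close>: one
    element is written both with a column permutation of places and with a column permutation of
    labels, and comparing signs gives the claim.\<close>
  define \<kappa> where "\<kappa> = s \<circ> g \<circ> t \<circ> inv g"
  have \<kappa>A: "\<kappa> permutes A"
    unfolding \<kappa>_def by (intro permutes_compose permutes_inv g tA sA)
  have "\<kappa> \<in> col_group"
  proof -
    have "c (\<kappa> a) = c a" if "a \<in> A" for a
      using all[of "inv g a"] that permutes_in_image[OF permutes_inv[OF g], of a]
      by (simp add: \<kappa>_def permutes_inverses[OF g])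
    then show ?thesis using \<kappa>A by (simp add: fiber_perms_def)
  qed
  have "\<kappa> \<circ> g = (s \<circ> g) \<circ> t"
    by (simp add: \<kappa>_def comp_assoc permutes_inv_o[OF g])
  then have E: "pm_scale (of_int (sign \<kappa>)) (alt_elem g) =
      pm_scale (of_int (sign t)) (alt_elem (s \<circ> g) :: ('a, 'k) group_algebra)"
    by (simp only: alt_elem_col[OF \<open>\<kappa> \<in> col_group\<close>, symmetric] alt_elem_label[OF t0, symmetric])
  have sk: "sign \<kappa> = sign s * sign t"
    unfolding \<kappa>_def
    by (simp add: sign_mult permutes_compose permutes_inv sign_inv g tA sA)
  have "pm_scale (of_int (sign s)) (alt_elem (s \<circ> g)) =
      pm_scale (of_int (sign s * sign t)) (pm_scale (of_int (sign t)) (alt_elem (s \<circ> g) :: ('a, 'k) group_algebra))"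
    by (simp add: mult.assoc flip: of_int_mult)
  also have "\<dots> = pm_scale (of_int (sign s * sign t * sign \<kappa>)) (alt_elem g)"
    by (simp only: E[symmetric] tensor.scale_scale of_int_mult)
  also have "sign s * sign t * sign \<kappa> = 1"
    unfolding sk by (metis mult.assoc sign_idempotent mult.commute mult.right_neutral)
  finally show "pm_scale (of_int (sign s)) (alt_elem (s \<circ> g)) = (alt_elem g :: ('a, 'k) group_algebra)"
    by (simp only: of_int_1 tensor.scale_one)
qed

text \<open>In the Garnir relation the terms in \<open>N\<close> all equal \<open>alt_elem g\<close>
  with the same sign, so they cannot cancel, and their number is invertible in characteristic zero.
  The terms in \<open>H\<close> have larger potential.\<close>

lemma exchange_relation:
  assumes g: "g permutes A" and e: "e < outer_letter" and j: "1 \<le> j"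
    and viol: "card {a \<in> A. c a = j} < card {a \<in> A. c a = j \<and> e \<le> letter (inv g a)} +
       card {a \<in> A. c a = Suc j \<and> letter (inv g a) \<le> e}"
    and noncore: "\<forall>a\<in>A - A0. c a \<le> c (g a)"
    and V: "tensor.subspace (V :: ('a, 'k::field_char_0) group_algebra set)"
    and higher: "\<And>h. h permutes A \<Longrightarrow> potential g < potential h \<Longrightarrow> \<forall>a\<in>A - A0. c a \<le> c (h a) \<Longrightarrow> alt_elem h \<in> V"
  shows "alt_elem g \<in> V"
proof -
  let ?X = "{a \<in> A. c a = j \<and> e \<le> letter (inv g a)}"
  let ?Y = "{a \<in> A. c a = Suc j \<and> letter (inv g a) \<le> e}"
  let ?term = "\<lambda>s. pm_scale (of_int (sign s)) (alt_elem (s \<circ> g)) :: ('a, 'k) group_algebra"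
  define N where "N = {s. s permutes ?X \<union> ?Y \<and> ?term s = alt_elem g}"
  define H where "H = {s. s permutes ?X \<union> ?Y \<and> ?term s \<noteq> alt_elem g}"
  have fin: "finite N" "finite H"
    by (rule finite_subset[of _ "{s. s permutes ?X \<union> ?Y}"];
        auto simp: N_def H_def intro: finite_permutations)+
  have "id \<in> N" by (simp add: N_def permutes_id)
  have H: "?term s \<in> V" if "s \<in> H" for s
  proof -
    have s: "s permutes ?X \<union> ?Y" and ne: "?term s \<noteq> alt_elem g" using that by (auto simp: H_def)
    have "s permutes A" by (rule permutes_subset[OF s]) auto
    then have "s \<circ> g permutes A" using g by (rule permutes_compose[rotated])
    moreover have "potential g < potential (s \<circ> g)"
      using exchange_term[OF g e order_refl order_refl s] ne by blast
    moreover have "\<forall>a\<in>A - A0. c a \<le> c ((s \<circ> g) a)"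
      using exchange_noncore[OF g order_refl order_refl s e] noncore
      by (auto intro: order_trans)
    ultimately show ?thesis using V higher by (intro tensor.subspace_scale)
  qed
  have "(\<Sum>s | s permutes ?X \<union> ?Y. ?term s) = 0"
    using viol by (intro garnir_alt not_inj_rows[OF _ _ j, of ?X ?Y]) auto
  also have "{s. s permutes ?X \<union> ?Y} = N \<union> H" by (auto simp: N_def H_def)
  also have "sum ?term (N \<union> H) = sum ?term N + sum ?term H"
    using fin by (intro sum.union_disjoint) (auto simp: N_def H_def)
  also have "sum ?term N = (\<Sum>s\<in>N. alt_elem g)" by (rule sum.cong) (auto simp: N_def)
  also have "\<dots> = pm_scale (of_nat (card N)) (alt_elem g)"
    by (rule poly_mapping_eqI) (simp add: lookup_sum)
  finally have "pm_scale (of_nat (card N)) (alt_elem g) = - sum ?term H"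
    by (simp only: eq_neg_iff_add_eq_0)
  then have "pm_scale (of_nat (card N)) (alt_elem g) \<in> V"
    using H V by (simp add: tensor.subspace_neg tensor.subspace_sum)
  then have "pm_scale (inverse (of_nat (card N))) (pm_scale (of_nat (card N)) (alt_elem g)) \<in> V"
    using V by (rule tensor.subspace_scale[rotated])
  moreover have "of_nat (card N) \<noteq> (0::'k)" using fin \<open>id \<in> N\<close> by auto
  ultimately show ?thesis by simp
qed

text \<open>This is what straightening leaves. The condition on outer labels is the invariant kept
  by exchanges; the other two conditions come from the absence of violations, after sorting
  columns.\<close>

definition standard :: "('a \<Rightarrow> 'a) \<Rightarrow> bool" where
  "standard g \<longleftrightarrow> g permutes A \<and> (\<forall>a\<in>A - A0. c a \<le> c (g a)) \<and> (\<forall>a\<in>A0. c (g a) \<le> c a) \<and>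
     (\<exists>\<delta>. is_partition \<delta> \<and> (\<lambda>a. (r a, c a)) ` g ` A0 = diagram \<delta>)"

text \<open>The assumption says that letters increase strictly along the rows once columns are sorted, but
  it does not require sorting.\<close>

lemma no_violation_left:
  assumes g: "g permutes A"
    and nov: "\<And>j e. 1 \<le> j \<Longrightarrow> e < outer_letter \<Longrightarrow> card {a \<in> A. c a = j \<and> e \<le> letter (inv g a)} +
       card {a \<in> A. c a = Suc j \<and> letter (inv g a) \<le> e} \<le> card {a \<in> A. c a = j}"
  shows "\<forall>a\<in>A. c a = j \<longrightarrow> j \<le> letter (inv g a)"
proof (induction j)
  case (Suc j)
  show ?case
  proof (intro ballI impI)
    fix a assume a: "a \<in> A" "c a = Suc j"
    have ia: "inv g a \<in> A" using a permutes_in_image[OF permutes_inv[OF g]] by simp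
    show "Suc j \<le> letter (inv g a)"
    proof (cases "j = 0")
      case True
      then show ?thesis using box_pos(2)[OF ia] by (simp add: letter_def outer_letter_def)
    next
      case False
      \<comment> \<open>With \<open>e = j\<close> the induction hypothesis makes the first count the
        whole column \<open>j\<close>, so no letter at most \<open>j\<close> can occur in column
        \<open>Suc j\<close>.\<close>
      have "j < outer_letter" using c_less_outer_letter[OF a(1)] a(2) by simp
      moreover have "{a \<in> A. c a = j \<and> j \<le> letter (inv g a)} = {a \<in> A. c a = j}"
        using Suc.IH by auto
      ultimately have "card {a \<in> A. c a = Suc j \<and> letter (inv g a) \<le> j} = 0"
        using nov[of j j] False by simp
      then have "{a \<in> A. c a = Suc j \<and> letter (inv g a) \<le> j} = {}"
        by (subst (asm) card_0_eq) auto
      then show ?thesis using a by (auto simp: not_le[symmetric] Suc_le_eq)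
    qed
  qed
qed simp

text \<open>For \<open>e\<close> one below \<open>outer_letter\<close>, the letters at most
  \<open>e\<close> are exactly those of inner labels. The outer labels of column \<open>j\<close>
  and the inner labels of column \<open>Suc j\<close> together then number at most the length of
  column \<open>j\<close>.\<close>

lemma no_violation_cols:
  assumes g: "g permutes A" and "1 \<le> j"
    and nov: "\<And>j e. 1 \<le> j \<Longrightarrow> e < outer_letter \<Longrightarrow> card {a \<in> A. c a = j \<and> e \<le> letter (inv g a)} +
       card {a \<in> A. c a = Suc j \<and> letter (inv g a) \<le> e} \<le> card {a \<in> A. c a = j}"
  shows "card {a \<in> g ` A0. c a = Suc j} \<le> card {a \<in> g ` A0. c a = j}"
proof -
  have in_g: "a \<in> g ` A0 \<longleftrightarrow> inv g a \<in> A0" for a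
  proof
    show "inv g a \<in> A0" if "a \<in> g ` A0" using that by (auto simp: permutes_inverses[OF g])
    show "a \<in> g ` A0" if "inv g a \<in> A0"
      using imageI[OF that, of g] by (simp add: permutes_inverses[OF g])
  qed
  have gA: "g ` A0 \<subseteq> A" using g A0_subset permutes_image by blast
  have core: "letter (inv g a) < outer_letter \<longleftrightarrow> a \<in> g ` A0" for a
    using c_less_outer_letter A0_subset by (auto simp: in_g letter_def)
  let ?e = "outer_letter - 1"
  have e: "?e < outer_letter" "\<And>a. letter (inv g a) \<le> ?e \<longleftrightarrow> a \<in> g ` A0"
    using core by (auto simp: outer_letter_def less_Suc_eq_le)
  have "card {a \<in> A. c a = j} = card ({a \<in> A. c a = j \<and> a \<notin> g ` A0} \<union> {a \<in> g ` A0. c a = j})"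
    using gA by (intro arg_cong[of _ _ card]) auto
  also have "\<dots> = card {a \<in> A. c a = j \<and> a \<notin> g ` A0} + card {a \<in> g ` A0. c a = j}"
    by (rule card_Un_disjoint) auto
  also have "card {a \<in> A. c a = j \<and> a \<notin> g ` A0} \<le> card {a \<in> A. c a = j \<and> ?e \<le> letter (inv g a)}"
  proof (intro card_mono subsetI)
    fix a assume "a \<in> {a \<in> A. c a = j \<and> a \<notin> g ` A0}"
    then show "a \<in> {a \<in> A. c a = j \<and> ?e \<le> letter (inv g a)}" using e(2)[of a] by auto
  qed simp
  finally have "card {a \<in> A. c a = j} \<le> card {a \<in> A. c a = j \<and> ?e \<le> letter (inv g a)} +
      card {a \<in> g ` A0. c a = j}" by simp
  moreover have "{a \<in> A. c a = Suc j \<and> letter (inv g a) \<le> ?e} = {a \<in> g ` A0. c a = Suc j}"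
    using e(2) gA by auto
  ultimately show ?thesis using nov[OF \<open>1 \<le> j\<close> e(1)] by simp
qed

section \<open>Sorting the columns into a partition diagram\<close>

lemma col_rows: "r ` {a \<in> A. c a = j} = {1..card {a \<in> A. c a = j}}"
proof -
  have "card {a \<in> A. c a = j} = card (r ` {a \<in> A. c a = j})"
    by (rule card_image[symmetric]) (auto intro!: inj_onI box_inj)
  moreover have "r ` {a \<in> A. c a = j} = {1..card (r ` {a \<in> A. c a = j})}"
  proof (rule down_closed_eq_atLeastAtMost)
    show "0 \<notin> r ` {a \<in> A. c a = j}" using box_pos(1) by fastforce
    fix i i' assume "i \<in> r ` {a \<in> A. c a = j}" "1 \<le> i'" "i' \<le> i"
    then obtain a where a: "a \<in> A" "c a = j" "1 \<le> i'" "i' \<le> r a" by auto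
    then obtain b where "b \<in> A" "r b = i'" "c b = j"
      using box_down[of a i' j] box_pos(2)[of a] by blast
    then show "i' \<in> r ` {a \<in> A. c a = j}" by blast
  qed simp
  ultimately show ?thesis by simp
qed

text \<open>Push the entries of \<open>B\<close> to the top of their columns, which produces
  \<open>U\<close>. Since the column counts \<open>d\<close> decrease, \<open>U\<close> is closed
  under moving up and left.\<close>

lemma sort_columns:
  assumes B: "B \<subseteq> A"
    and dec: "\<And>j. 1 \<le> j \<Longrightarrow> card {a \<in> B. c a = Suc j} \<le> card {a \<in> B. c a = j}"
  obtains t \<delta> where "t \<in> col_group" "is_partition \<delta>" "(\<lambda>a. (r a, c a)) ` t ` B = diagram \<delta>"
proof -
  define d where "d j = card {a \<in> B. c a = j}" for j
  define U where "U = {a \<in> A. r a \<le> d (c a)}"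
  have finB: "finite B" using B finite_A by (rule finite_subset)
  have d_le: "d j \<le> card {a \<in> A. c a = j}" for j
    unfolding d_def using B by (intro card_mono) auto
  have dec': "d j' \<le> d j" if "1 \<le> j" "j \<le> j'" for j j'
    using that(2,1)
  proof (induction rule: dec_induct)
    case (step n)
    then show ?case using dec[of n] by (simp add: d_def)
  qed simp
  have U_col: "card {a \<in> A. c a = j \<and> a \<in> U} = d j" for j
  proof -
    have "r ` {a \<in> A. c a = j \<and> a \<in> U} = r ` {a \<in> A. c a = j} \<inter> {..d j}" by (auto simp: U_def)
    also have "\<dots> = {1..d j}" unfolding col_rows using d_le[of j] by auto
    finally have "card (r ` {a \<in> A. c a = j \<and> a \<in> U}) = d j" by simp
    moreover have "inj_on r {a \<in> A. c a = j \<and> a \<in> U}" by (auto intro!: inj_onI box_inj)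
    ultimately show ?thesis by (simp add: card_image)
  qed
  have split: "{a \<in> A. (c a, a \<in> W) = (j, b)} =
      (if b then {a \<in> A. c a = j \<and> a \<in> W} else {a \<in> A. c a = j} - {a \<in> A. c a = j \<and> a \<in> W})"
    for W :: "'a set" and j b by auto
  have diff: "card ({a \<in> A. c a = j} - {a \<in> A. c a = j \<and> a \<in> W}) =
      card {a \<in> A. c a = j} - card {a \<in> A. c a = j \<and> a \<in> W}" for W j
    by (rule card_Diff_subset) auto
  have cB: "card {a \<in> A. c a = j \<and> a \<in> B} = d j" for j
    unfolding d_def using B by (intro arg_cong[of _ _ card]) auto
  \<comment> \<open>Comparing column and membership simultaneously yields a matching permutation
    that preserves columns and carries \<open>B\<close> onto \<open>U\<close>.\<close>
  have "image_mset (\<lambda>a. (c a, a \<in> B)) (mset_set A) = image_mset (\<lambda>a. (c a, a \<in> U)) (mset_set A)"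
  proof (rule multiset_eqI)
    fix y :: "nat \<times> bool"
    obtain j b where y: "y = (j, b)" by (cases y)
    have "card {a \<in> A. (c a, a \<in> B) = y} = card {a \<in> A. (c a, a \<in> U) = y}"
      unfolding y split by (simp add: U_col cB diff)
    then show "count (image_mset (\<lambda>a. (c a, a \<in> B)) (mset_set A)) y =
        count (image_mset (\<lambda>a. (c a, a \<in> U)) (mset_set A)) y"
      by (simp add: count_image_mset' eq_commute[of y])
  qed
  then obtain t where t: "t permutes A" "\<forall>a\<in>A. (c a, a \<in> B) = (c (t a), t a \<in> U)"
    by (rule image_mset_eq_implies_permutes[OF finite_A])
  have tc: "t \<in> col_group" using t by (auto simp: fiber_perms_def)
  have "t ` B = U"
  proof (intro equalityI subsetI)
    fix b assume "b \<in> U"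
    then have "b \<in> A" by (simp add: U_def)
    then obtain a where "a \<in> A" "b = t a" using permutes_image[OF t(1)] by auto
    then show "b \<in> t ` B" using t(2) \<open>b \<in> U\<close> by auto
  qed (use t(2) B in auto)
  have "\<exists>\<delta>. is_partition \<delta> \<and> diagram \<delta> = (\<lambda>a. (r a, c a)) ` U"
  proof (rule ex_partition_diagram)
    fix i j i' j' assume ij: "(i, j) \<in> (\<lambda>a. (r a, c a)) ` U" "1 \<le> i'" "i' \<le> i" "1 \<le> j'" "j' \<le> j"
    then obtain a where a: "a \<in> A" "r a \<le> d (c a)" "i = r a" "j = c a" by (auto simp: U_def)
    obtain b where b: "b \<in> A" "r b = i'" "c b = j'"
      by (rule box_down[OF a(1) ij(2) _ ij(4)]) (use a ij in auto)
    moreover have "d j \<le> d j'" using dec' ij by simp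
    ultimately show "(i', j') \<in> (\<lambda>a. (r a, c a)) ` U"
      using a ij by (intro image_eqI[of _ _ b]) (auto simp: U_def)
  qed (use box_pos in \<open>auto simp: U_def\<close>)
  then show ?thesis using that[OF tc] \<open>t ` B = U\<close> by auto
qed

section \<open>Termination of straightening and the leftward terms\<close>

lemma potential_bounded: "g permutes A \<Longrightarrow> potential g \<le> card A * (outer_letter * outer_letter)"
proof -
  assume g: "g permutes A"
  have "letter a * c (g a) \<le> outer_letter * outer_letter" if "a \<in> A" for a
    using that g letter_le_outer_letter c_less_outer_letter[of "g a"] by (intro mult_mono) (auto simp: permutes_in_image)
  then show ?thesis unfolding potential_def using sum_bounded_above[of A "\<lambda>a. letter a * c (g a)" "outer_letter * outer_letter"] by simp
qed

text \<open>Every violation is traded for terms of larger potential, and the potential is bounded.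
  Without a violation only the columns remain to be sorted, which costs a sign.\<close>

lemma straighten:
  assumes "g permutes A" "\<forall>a\<in>A - A0. c a \<le> c (g a)"
  shows "(alt_elem g :: ('a, 'k::field_char_0) group_algebra) \<in> tensor.span (alt_elem ` Collect standard)"
  using assms
proof (induction "card A * (outer_letter * outer_letter) - potential g" arbitrary: g rule: less_induct)
  case less
  note g = less.prems(1)
  let ?V = "tensor.span (alt_elem ` Collect standard) :: ('a, 'k) group_algebra set"
  show ?case
  proof (cases "\<exists>j e. 1 \<le> j \<and> e < outer_letter \<and> card {a \<in> A. c a = j} <
      card {a \<in> A. c a = j \<and> e \<le> letter (inv g a)} + card {a \<in> A. c a = Suc j \<and> letter (inv g a) \<le> e}")
    case True
    then obtain j e where je: "1 \<le> j" "e < outer_letter" "card {a \<in> A. c a = j} <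
      card {a \<in> A. c a = j \<and> e \<le> letter (inv g a)} + card {a \<in> A. c a = Suc j \<and> letter (inv g a) \<le> e}"
      by blast
    show ?thesis
    proof (rule exchange_relation[OF g je(2,1,3) less.prems(2)])
      fix h assume h: "h permutes A" "potential g < potential h" "\<forall>a\<in>A - A0. c a \<le> c (h a)"
      then show "alt_elem h \<in> ?V"
        using potential_bounded[OF h(1)] by (intro less.hyps) auto
    qed (rule tensor.subspace_span)
  next
    case False
    then have nov: "card {a \<in> A. c a = j \<and> e \<le> letter (inv g a)} +
       card {a \<in> A. c a = Suc j \<and> letter (inv g a) \<le> e} \<le> card {a \<in> A. c a = j}"
      if "1 \<le> j" "e < outer_letter" for j e using that by (meson not_le)
    have gA: "g ` A0 \<subseteq> A" using g A0_subset permutes_image by blast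
    obtain t \<delta> where t: "t \<in> col_group" "is_partition \<delta>" "(\<lambda>a. (r a, c a)) ` t ` g ` A0 = diagram \<delta>"
      using sort_columns[OF gA no_violation_cols[OF g _ nov]] by blast
    have left: "c (g a) \<le> c a" if a: "a \<in> A0" for a
    proof -
      have "g a \<in> A" using gA a by auto
      then have "c (g a) \<le> letter (inv g (g a))" using no_violation_left[OF g nov] by blast
      then show ?thesis using a by (simp add: permutes_inverses[OF g] letter_def)
    qed
    have "standard (t \<circ> g)"
      unfolding standard_def using t g left less.prems(2) fiber_perms_apply[OF t(1)]
      by (auto simp: image_comp permutes_compose fiber_perms_permutes)
    then have "pm_scale (of_int (sign t)) (alt_elem (t \<circ> g)) \<in> ?V"
      by (intro tensor.span_scale tensor.span_base) auto
    then show ?thesis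
      by (simp add: alt_elem_col[OF t(1)] flip: of_int_mult)
  qed
qed

text \<open>The conditions that define \<open>\<G>\<close>, transported to permutations:
  \<open>g a\<close> marks the new place of the label \<open>a\<close>.\<close>

definition leftward :: "('a \<Rightarrow> 'a) \<Rightarrow> bool" where
  "leftward g \<longleftrightarrow> g permutes A \<and> (\<forall>a\<in>A0. c (g a) \<le> c a) \<and> (\<exists>a\<in>A0. c (g a) < c a) \<and>
     (\<exists>\<delta>. is_partition \<delta> \<and> (\<lambda>a. (r a, c a)) ` g ` A0 = diagram \<delta>)"

text \<open>If an inner label moves strictly left, every term of the expansion is leftward, as the
  column group of \<open>S\<close> preserves columns and \<open>A0\<close>. Otherwise no label moves
  left; the fixed sum of columns then makes \<open>g\<close> a column permutation, and all terms are
  multiples of \<open>young_elem id\<close>.\<close>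

lemma alt_elem_standard:
  assumes st: "standard g"
  shows "(alt_elem g :: ('a, 'k::field_char_0) group_algebra) \<in>
    tensor.span (insert (young_elem id) (young_elem ` Collect leftward))"
    (is "_ \<in> tensor.span ?S")
proof (cases "\<exists>a\<in>A0. c (g a) < c a")
  case True
  have "young_elem (g \<circ> t) \<in> (?S :: ('a, 'k) group_algebra set)" if t: "t \<in> col_group0" for t
  proof -
    have tp: "t permutes A0" using t by (rule fiber_perms_permutes)
    obtain a where a: "a \<in> A0" "c (g a) < c a" using True by auto
    have 1: "inv t a \<in> A0" "c (g (t (inv t a))) < c (inv t a)"
      using a permutes_in_image[OF permutes_inv[OF tp]] fiber_perms_apply[OF t, of "inv t a"]
      by (auto simp: permutes_inverses[OF tp])
    have 2: "c (g (t b)) \<le> c b" if "b \<in> A0" for b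
    proof -
      have "t b \<in> A0" using that permutes_in_image[OF tp] by simp
      then have "c (g (t b)) \<le> c (t b)" using st by (auto simp: standard_def)
      then show ?thesis by (simp add: fiber_perms_apply[OF t])
    qed
    have 3: "(g \<circ> t) ` A0 = g ` A0" by (simp only: image_comp[symmetric] permutes_image[OF tp])
    have 4: "g \<circ> t permutes A"
      using st permutes_A0[OF tp] by (auto simp: standard_def intro: permutes_compose)
    have "leftward (g \<circ> t)"
      unfolding leftward_def 3 using st 1 2 4 by (auto simp: standard_def)
    then show ?thesis by blast
  qed
  then show ?thesis
    unfolding alt_elem_def by (intro tensor.span_sum tensor.span_scale tensor.span_base)
next
  case False
  have g: "g permutes A" using st by (simp add: standard_def)
  have ge: "c a \<le> c (g a)" if "a \<in> A" for a
    using st False that by (cases "a \<in> A0") (auto simp: standard_def not_less)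
  have "c a = c (g a)" if "a \<in> A" for a
  proof (rule ccontr)
    assume "c a \<noteq> c (g a)"
    then have "(\<Sum>a\<in>A. c a) < (\<Sum>a\<in>A. c (g a))"
      using ge that by (intro sum_strict_mono_ex1 ballI bexI[of _ a]) (auto simp: order_less_le)
    then show False using sum_c_permutes[OF g, of id] by simp
  qed
  then have gc: "g \<in> col_group" using g by (simp add: fiber_perms_def)
  have "young_elem t \<in> tensor.span (?S :: ('a, 'k) group_algebra set)" if t: "t \<in> col_group0" for t
  proof -
    have "t \<in> col_group" using t fiber_perms_subset[OF A0_subset] by auto
    then show ?thesis
      using young_elem_col[of t id, where ?'k = 'k] by (simp add: tensor.span_scale tensor.span_base)
  qed
  then have "alt_elem id \<in> tensor.span (?S :: ('a, 'k) group_algebra set)"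
    unfolding alt_elem_def by (intro tensor.span_sum tensor.span_scale) simp
  then show ?thesis
    using alt_elem_col[OF gc, of id, where ?'k = 'k] by (simp add: tensor.span_scale)
qed

section \<open>The coefficient of the identity\<close>

text \<open>In the notation of the overview this is c(T) c(S).\<close>

definition core_product :: "('a, 'k::field) group_algebra" where
  "core_product = (\<Sum>p\<in>row_group0. alt_elem p)"

text \<open>Row permutations of \<open>S\<close> fix the outer labels, so the invariant required for
  straightening holds at the start.\<close>

lemma core_product_in_span:
  "(core_product :: ('a, 'k::field_char_0) group_algebra) \<in>
    tensor.span (insert (young_elem id) (young_elem ` Collect leftward))"
proof -
  have "alt_elem p \<in> tensor.span (insert (young_elem id) (young_elem ` Collect leftward) :: ('a, 'k) group_algebra set)"
    if p: "p \<in> row_group0" for p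
  proof -
    have "p permutes A0" using p by (rule fiber_perms_permutes)
    then have "p permutes A" "\<forall>a\<in>A - A0. c a \<le> c (p a)"
      by (auto simp: permutes_A0 permutes_not_in)
    then have "alt_elem p \<in> tensor.span (alt_elem ` Collect standard :: ('a, 'k) group_algebra set)"
      by (rule straighten)
    moreover have "tensor.span (alt_elem ` Collect standard) \<subseteq>
      tensor.span (insert (young_elem id) (young_elem ` Collect leftward) :: ('a, 'k) group_algebra set)"
      using alt_elem_standard by (intro tensor.span_minimal) auto
    ultimately show ?thesis by blast
  qed
  then show ?thesis unfolding core_product_def by (intro tensor.span_sum)
qed

text \<open>The function \<open>c - \<mu>\<^sub>r\<close> is positive outside the inner diagram and nonpositive inside it.\<close>

lemma row_shift_col_sum:
  assumes B: "B \<subseteq> A" and p: "p \<in> row_group" "p ` B = A0"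
  shows "(\<Sum>a\<in>A0. c a) \<le> (\<Sum>a\<in>B. c a)" and "(\<Sum>a\<in>B. c a) = (\<Sum>a\<in>A0. c a) \<Longrightarrow> B = A0"
proof -
  define f where "f a = int (c a) - int (part mu (r a))" for a
  have finB: "finite B" using B finite_A by (rule finite_subset)
  have inj: "inj_on p B" using p(1) by (auto intro: permutes_inj_on fiber_perms_permutes)
  \<comment> \<open>A row permutation does not change \<open>part mu (r a)\<close>, so the two
    column sums may be compared through \<open>f\<close>.\<close>
  have "(\<Sum>a\<in>A0. int (part mu (r a))) = (\<Sum>a\<in>B. int (part mu (r a)))"
    unfolding p(2)[symmetric] using inj by (simp add: sum.reindex fiber_perms_apply[OF p(1)])
  then have "int (\<Sum>a\<in>B. c a) - int (\<Sum>a\<in>A0. c a) = sum f B - sum f A0"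
    by (simp add: f_def sum_subtractf)
  also have "\<dots> = sum f (B - A0) - sum f (A0 - B)"
    using finB sum.Int_Diff[of B f A0] sum.Int_Diff[of A0 f B] by (simp add: Int_commute)
  finally have diff: "int (\<Sum>a\<in>B. c a) - int (\<Sum>a\<in>A0. c a) = sum f (B - A0) - sum f (A0 - B)" .
  have pos: "0 < f a" if "a \<in> B - A0" for a
    using that B box_pos[of a] by (auto simp: f_def A0_def diagram_def)
  have neg: "f a \<le> 0" if "a \<in> A0 - B" for a
    using that by (auto simp: f_def A0_def diagram_def)
  have le: "sum f (A0 - B) \<le> 0" by (rule sum_nonpos) (use neg in auto)
  have ge: "0 \<le> sum f (B - A0)" by (rule sum_nonneg) (use pos in force)
  show "(\<Sum>a\<in>A0. c a) \<le> (\<Sum>a\<in>B. c a)" using diff le ge by linarith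
  assume "(\<Sum>a\<in>B. c a) = (\<Sum>a\<in>A0. c a)"
  then have "sum f (B - A0) = 0" using diff le ge by linarith
  then have "B - A0 = {}"
    using sum_pos[of "B - A0" f] finB pos by (metis finite_Diff less_irrefl)
  moreover have "card B = card A0" using card_image[OF inj] p(2) by simp
  ultimately show "B = A0" by (intro card_subset_eq) auto
qed

text \<open>Summing over the whole row group of \<open>S\<close> is what relates the value on the
  core product to a sum of squares.\<close>

definition row_functional :: "('a, 'k::field) group_algebra \<Rightarrow> 'k" where
  "row_functional x = (\<Sum>q\<in>row_group0. Poly_Mapping.lookup x q)"

text \<open>If \<open>p \<circ> t \<circ> h\<close> were a row permutation of \<open>S\<close>, then
  \<open>p\<close> would carry the image of \<open>A0\<close> under \<open>t \<circ> h\<close> back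
  to \<open>A0\<close>. That image would have at least the column sum of \<open>A0\<close>, whereas
  \<open>h\<close> has lowered it.\<close>

lemma row_functional_leftward:
  assumes "leftward h"
  shows "row_functional (young_elem h) = 0"
proof -
  have "p \<circ> t \<circ> h \<noteq> q" if p: "p \<in> row_group" and t: "t \<in> col_group" and q: "q \<in> row_group0" for p t q
  proof
    assume eq: "p \<circ> t \<circ> h = q"
    have h: "h permutes A" using assms by (simp add: leftward_def)
    have th: "t \<circ> h permutes A" using h t by (auto intro: permutes_compose fiber_perms_permutes)
    have "p ` (t \<circ> h) ` A0 = q ` A0" by (simp add: eq[symmetric] image_comp comp_assoc)
    also have "\<dots> = A0" by (rule permutes_image[OF fiber_perms_permutes[OF q]])
    finally have "(\<Sum>a\<in>A0. c a) \<le> (\<Sum>a\<in>(t \<circ> h) ` A0. c a)"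
      using th A0_subset permutes_image[OF th] by (intro row_shift_col_sum(1)[OF _ p]) auto
    also have "\<dots> = (\<Sum>a\<in>A0. c (h a))"
      using th by (subst sum.reindex) (auto intro: permutes_inj_on simp: fiber_perms_apply[OF t])
    also have "\<dots> < (\<Sum>a\<in>A0. c a)"
      using assms by (intro sum_strict_mono_ex1) (auto simp: leftward_def)
    finally show False by simp
  qed
  then show ?thesis
    by (simp add: row_functional_def young_elem_def lookup_sum lookup_single when_def)
qed

text \<open>Column permutations keep column sums, so the equality case of
  \<open>row_shift_col_sum\<close> shows that \<open>t\<close> preserves \<open>A0\<close>. Outside
  \<open>A0\<close>, the entries \<open>a\<close> and \<open>t a\<close> share both row and column,
  so \<open>t\<close> and then \<open>p\<close> fix \<open>a\<close>.\<close>

lemma row_col_factor: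
  assumes p: "p \<in> row_group" and t: "t \<in> col_group" and pt: "p \<circ> t permutes A0"
  shows "p \<in> row_group0" "t \<in> col_group0"
proof -
  have tp: "t permutes A" and pp: "p permutes A" using p t by (auto intro: fiber_perms_permutes)
  have tB: "t ` A0 = A0"
  proof (rule row_shift_col_sum(2)[OF _ p])
    show "t ` A0 \<subseteq> A" using A0_subset permutes_image[OF tp] by auto
    show "p ` t ` A0 = A0" using permutes_image[OF pt] by (simp add: image_comp)
    show "(\<Sum>a\<in>t ` A0. c a) = (\<Sum>a\<in>A0. c a)"
      using tp by (subst sum.reindex) (auto intro: permutes_inj_on simp: fiber_perms_apply[OF t])
  qed
  have fix_t: "t a = a" if "a \<notin> A0" for a
  proof (cases "a \<in> A")
    case True
    have "p (t a) = a" using permutes_not_in[OF pt that] by simp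
    then have "r (t a) = r a" using fiber_perms_apply[OF p, of "t a"] by simp
    moreover have "t a \<in> A" using True permutes_in_image[OF tp] by simp
    ultimately show ?thesis using True by (intro box_inj) (auto simp: fiber_perms_apply[OF t])
  qed (simp add: permutes_not_in[OF tp])
  have fix_p: "p a = a" if "a \<notin> A0" for a
    using permutes_not_in[OF pt that] fix_t[OF that] by simp
  have sub: "q permutes A0" if "q permutes A" "\<And>a. a \<notin> A0 \<Longrightarrow> q a = a" for q
    using that by (metis (no_types, lifting) DiffE permutes_superset)
  show "p \<in> row_group0" "t \<in> col_group0"
    using sub[OF pp fix_p] sub[OF tp fix_t] fiber_perms_apply[OF p] fiber_perms_apply[OF t]
    by (auto simp: fiber_perms_def)
qed

text \<open>The coefficient of \<open>x\<close> in \<open>a(S) b(S) a(S)\<close>.\<close>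

definition aba_coeff :: "('a \<Rightarrow> 'a) \<Rightarrow> int" where
  "aba_coeff x = (\<Sum>p\<in>row_group0. \<Sum>t\<in>col_group0. \<Sum>p'\<in>row_group0.
     if p \<circ> t \<circ> p' = x then sign t else 0)"

text \<open>The right-hand factor a(S) absorbs row permutations without a sign.\<close>

lemma aba_coeff_row:
  assumes q: "q \<in> row_group0"
  shows "aba_coeff (x \<circ> q) = aba_coeff x"
proof -
  have qp: "q permutes A0" using q by (rule fiber_perms_permutes)
  have eq: "p \<circ> t \<circ> (p' \<circ> q) = x \<circ> q \<longleftrightarrow> p \<circ> t \<circ> p' = x" for p t p'
  proof
    assume "p \<circ> t \<circ> (p' \<circ> q) = x \<circ> q"
    then have "p \<circ> t \<circ> (p' \<circ> q) \<circ> inv q = x \<circ> q \<circ> inv q" by simp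
    then show "p \<circ> t \<circ> p' = x" by (simp add: comp_assoc permutes_inv_o[OF qp])
  qed (simp add: comp_assoc[symmetric])
  have "(\<Sum>p'\<in>row_group0. if p \<circ> t \<circ> p' = x \<circ> q then sign t else 0) =
     (\<Sum>p'\<in>row_group0. if p \<circ> t \<circ> p' = x then sign t else 0)" for p t
    using sum_fiber_perms_compose_right[OF q, of "\<lambda>p'. if p \<circ> t \<circ> p' = x \<circ> q then sign t else 0"]
    by (simp only: eq)
  then show ?thesis unfolding aba_coeff_def by simp
qed

text \<open>If the product of the three factors is \<open>id\<close>, the column permutation in the
  middle preserves rows too and is trivial. So no term is negative, and the identity triple
  contributes 1.\<close>

lemma aba_coeff_id_pos: "0 < aba_coeff id"
proof -
  have one: "(if p \<circ> t \<circ> p' = id then sign t else 0) = (if p \<circ> t \<circ> p' = id then 1 else 0)"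
    if p: "p \<in> row_group0" and t: "t \<in> col_group0" and p': "p' \<in> row_group0" for p t p'
  proof -
    have "t = id" if e: "p \<circ> t \<circ> p' = id"
    proof
      fix a
      have pp: "p' permutes A0" and tp: "t permutes A0" using p' t by (auto intro: fiber_perms_permutes)
      have "p (t a) = inv p' a"
        using fun_cong[OF e, of "inv p' a"] by (simp add: permutes_inverses[OF pp])
      then have "r (t a) = r (inv p' a)" using fiber_perms_apply[OF p, of "t a"] by simp
      also have "\<dots> = r a" using p' by (intro fiber_perms_apply) (rule fiber_perms_inv)
      finally have "r (t a) = r a" .
      moreover have "t a \<in> A" if "a \<in> A"
        using that permutes_A0[OF tp] by (simp add: permutes_in_image)
      ultimately show "t a = id a"
        using fiber_perms_apply[OF t] box_inj[of "t a" a] permutes_not_in[OF permutes_A0[OF tp], of a]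
        by (cases "a \<in> A") auto
    qed
    then show ?thesis by auto
  qed
  have eq: "aba_coeff id = (\<Sum>p\<in>row_group0. \<Sum>t\<in>col_group0. \<Sum>p'\<in>row_group0.
     if p \<circ> t \<circ> p' = id then 1 else 0)"
    unfolding aba_coeff_def by (intro sum.cong refl one)
  show ?thesis unfolding eq
    by (intro sum_pos2[of _ id] sum_nonneg) simp_all
qed

text \<open>If \<open>p \<circ> t \<circ> p' \<circ> t'\<close> lies in the row group of
  \<open>S\<close>, then \<open>p \<circ> t\<close> permutes \<open>A0\<close>, so by
  \<open>row_col_factor\<close> only factors from the inner groups contribute. Collecting the first
  three factors gives \<open>aba_coeff\<close>, and inverting \<open>t'\<close> keeps its
  sign.\<close>

lemma row_functional_core_product:
  "row_functional (core_product :: ('a, 'k::field) group_algebra) =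
    of_int (\<Sum>q\<in>row_group0. \<Sum>t\<in>col_group0. sign t * aba_coeff (q \<circ> t))"
proof -
  have inner: "(\<Sum>p\<in>row_group. \<Sum>t\<in>col_group. if p \<circ> t \<circ> (p' \<circ> t') = q then sign t else 0) =
     (\<Sum>p\<in>row_group0. \<Sum>t\<in>col_group0. if p \<circ> t \<circ> p' = q \<circ> inv t' then sign t else 0)"
    if p': "p' \<in> row_group0" and t': "t' \<in> col_group0" and q: "q \<in> row_group0" for p' t' q
  proof -
    have perms: "p' permutes A0" "t' permutes A0" "q permutes A0"
      using p' t' q by (auto intro: fiber_perms_permutes)
    have eq: "p \<circ> t \<circ> (p' \<circ> t') = q \<longleftrightarrow> p \<circ> t \<circ> p' = q \<circ> inv t'" for p t
    proof
      assume "p \<circ> t \<circ> (p' \<circ> t') = q"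
      then show "p \<circ> t \<circ> p' = q \<circ> inv t'"
        by (auto simp: comp_assoc permutes_inv_o[OF perms(2)])
    next
      assume "p \<circ> t \<circ> p' = q \<circ> inv t'"
      then have "p \<circ> t \<circ> p' \<circ> t' = q \<circ> inv t' \<circ> t'" by simp
      then show "p \<circ> t \<circ> (p' \<circ> t') = q" by (simp add: comp_assoc permutes_inv_o[OF perms(2)])
    qed
    have mem: "p \<in> row_group0 \<and> t \<in> col_group0"
      if "p \<in> row_group" "t \<in> col_group" "p \<circ> t \<circ> p' = q \<circ> inv t'" for p t
    proof -
      have "p \<circ> t \<circ> p' \<circ> inv p' = q \<circ> inv t' \<circ> inv p'" using that by simp
      then have "p \<circ> t = q \<circ> inv t' \<circ> inv p'" by (simp add: comp_assoc permutes_inv_o[OF perms(1)])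
      then have "p \<circ> t permutes A0" using perms by (auto intro!: permutes_compose permutes_inv)
      then show ?thesis using row_col_factor that by blast
    qed
    have "(\<Sum>(p, t)\<in>row_group \<times> col_group. if p \<circ> t \<circ> p' = q \<circ> inv t' then sign t else 0) =
       (\<Sum>(p, t)\<in>row_group0 \<times> col_group0. if p \<circ> t \<circ> p' = q \<circ> inv t' then sign t else 0)"
      using fiber_perms_subset[OF A0_subset] mem
      by (intro sum.mono_neutral_right) (auto split: if_splits)
    then show ?thesis by (simp add: eq sum.cartesian_product)
  qed
  have aba: "(\<Sum>p'\<in>row_group0. \<Sum>p\<in>row_group0. \<Sum>t\<in>col_group0. if p \<circ> t \<circ> p' = x then sign t else 0) =
       aba_coeff x" for x
    unfolding aba_coeff_def
    by (rule trans[OF sum.swap], rule sum.cong[OF refl], rule sum.swap)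
  have "row_functional (core_product :: ('a, 'k) group_algebra) =
     (\<Sum>q\<in>row_group0. \<Sum>p'\<in>row_group0. \<Sum>t'\<in>col_group0. of_int (sign t') *
       of_int (\<Sum>p\<in>row_group. \<Sum>t\<in>col_group. if p \<circ> t \<circ> (p' \<circ> t') = q then sign t else 0))"
    unfolding row_functional_def core_product_def alt_elem_def young_elem_def
    by (simp add: lookup_sum lookup_single when_def if_distrib[of of_int] cong: if_cong)
  also have "\<dots> = of_int (\<Sum>q\<in>row_group0. \<Sum>p'\<in>row_group0. \<Sum>t'\<in>col_group0. sign t' *
       (\<Sum>p\<in>row_group. \<Sum>t\<in>col_group. if p \<circ> t \<circ> (p' \<circ> t') = q then sign t else 0))"
    by simp
  also have "(\<Sum>q\<in>row_group0. \<Sum>p'\<in>row_group0. \<Sum>t'\<in>col_group0. sign t' *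
       (\<Sum>p\<in>row_group. \<Sum>t\<in>col_group. if p \<circ> t \<circ> (p' \<circ> t') = q then sign t else 0)) =
     (\<Sum>q\<in>row_group0. \<Sum>p'\<in>row_group0. \<Sum>t'\<in>col_group0. sign t' *
       (\<Sum>p\<in>row_group0. \<Sum>t\<in>col_group0. if p \<circ> t \<circ> p' = q \<circ> inv t' then sign t else 0))"
    by (intro sum.cong refl arg_cong2[of _ _ _ _ "(*)"] inner)
  also have "\<dots> = (\<Sum>q\<in>row_group0. \<Sum>t'\<in>col_group0. sign t' * aba_coeff (q \<circ> inv t'))"
  proof (rule sum.cong[OF refl])
    fix q
    have "(\<Sum>p'\<in>row_group0. \<Sum>t'\<in>col_group0. sign t' *
       (\<Sum>p\<in>row_group0. \<Sum>t\<in>col_group0. if p \<circ> t \<circ> p' = q \<circ> inv t' then sign t else 0)) =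
       (\<Sum>t'\<in>col_group0. \<Sum>p'\<in>row_group0. sign t' *
       (\<Sum>p\<in>row_group0. \<Sum>t\<in>col_group0. if p \<circ> t \<circ> p' = q \<circ> inv t' then sign t else 0))"
      by (rule sum.swap)
    also have "\<dots> = (\<Sum>t'\<in>col_group0. sign t' * (\<Sum>p'\<in>row_group0.
       \<Sum>p\<in>row_group0. \<Sum>t\<in>col_group0. if p \<circ> t \<circ> p' = q \<circ> inv t' then sign t else 0))"
      by (simp only: sum_distrib_left)
    also have "\<dots> = (\<Sum>t'\<in>col_group0. sign t' * aba_coeff (q \<circ> inv t'))"
      by (simp only: aba)
    finally show "(\<Sum>p'\<in>row_group0. \<Sum>t'\<in>col_group0. sign t' *
       (\<Sum>p\<in>row_group0. \<Sum>t\<in>col_group0. if p \<circ> t \<circ> p' = q \<circ> inv t' then sign t else 0)) =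
       (\<Sum>t'\<in>col_group0. sign t' * aba_coeff (q \<circ> inv t'))" .
  qed
  also have "\<dots> = (\<Sum>q\<in>row_group0. \<Sum>t'\<in>col_group0. sign t' * aba_coeff (q \<circ> t'))"
  proof (rule sum.cong[OF refl])
    fix q
    have "(\<Sum>t'\<in>col_group0. sign t' * aba_coeff (q \<circ> inv t')) =
       (\<Sum>t'\<in>col_group0. sign (inv t') * aba_coeff (q \<circ> inv t'))"
      by (intro sum.cong refl) (simp add: sign_inv permutes_A0 fiber_perms_permutes)
    also have "\<dots> = (\<Sum>t'\<in>col_group0. sign t' * aba_coeff (q \<circ> t'))"
      by (rule sum_fiber_perms_inv)
    finally show "(\<Sum>t'\<in>col_group0. sign t' * aba_coeff (q \<circ> inv t')) =
      (\<Sum>t'\<in>col_group0. sign t' * aba_coeff (q \<circ> t'))" .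
  qed
  finally show ?thesis .
qed

text \<open>Expand one factor in the sum of squares of \<open>aba_coeff\<close>. By right invariance
  the innermost row permutation contributes only the order of the row group, so a positive integer
  is that order times \<open>?L\<close>.\<close>

lemma row_functional_core_product_nonzero:
  "row_functional (core_product :: ('a, 'k::field_char_0) group_algebra) \<noteq> 0"
proof -
  let ?P = "{x. x permutes A0}"
  let ?L = "\<Sum>q\<in>row_group0. \<Sum>t\<in>col_group0. sign t * aba_coeff (q \<circ> t)"
  have finP: "finite ?P" by (simp add: finite_permutations)
  have "0 < (\<Sum>x\<in>?P. aba_coeff x * aba_coeff x)"
    using aba_coeff_id_pos finP by (intro sum_pos2[of _ id]) (auto simp: permutes_id)
  also have "(\<Sum>x\<in>?P. aba_coeff x * aba_coeff x) =
    (\<Sum>x\<in>?P. \<Sum>p\<in>row_group0. \<Sum>t\<in>col_group0. \<Sum>p'\<in>row_group0.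
       if p \<circ> t \<circ> p' = x then sign t * aba_coeff x else 0)"
    by (subst (2) aba_coeff_def)
      (simp add: sum_distrib_left if_distrib mult.commute cong: if_cong)
  also have "\<dots> = (\<Sum>p\<in>row_group0. \<Sum>t\<in>col_group0. \<Sum>p'\<in>row_group0. \<Sum>x\<in>?P.
       if p \<circ> t \<circ> p' = x then sign t * aba_coeff x else 0)"
    by (rule trans[OF sum.swap], rule sum.cong[OF refl], rule trans[OF sum.swap],
        rule sum.cong[OF refl], rule sum.swap)
  also have "\<dots> = (\<Sum>p\<in>row_group0. \<Sum>t\<in>col_group0. \<Sum>p'\<in>row_group0. sign t * aba_coeff (p \<circ> t))"
  proof (intro sum.cong refl)
    fix p t p' assume *: "p \<in> row_group0" "t \<in> col_group0" "p' \<in> row_group0"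
    have "p \<circ> t \<circ> p' \<in> ?P"
      using *[THEN fiber_perms_permutes] by (simp add: permutes_compose)
    then show "(\<Sum>x\<in>?P. if p \<circ> t \<circ> p' = x then sign t * aba_coeff x else 0) = sign t * aba_coeff (p \<circ> t)"
      using finP by (simp add: aba_coeff_row[OF *(3)])
  qed
  also have "\<dots> = int (card row_group0) * ?L"
    by (simp add: sum_distrib_left)
  finally have "?L \<noteq> 0" by auto
  then show ?thesis unfolding row_functional_core_product of_int_eq_0_iff .
qed

text \<open>Straightening writes the core product as \<open>b\<close> times
  \<open>young_elem id\<close> plus leftward terms. Applying \<open>row_functional\<close> excludes
  \<open>b = 0\<close>, so the relation can be solved for \<open>young_elem id\<close>.\<close>

theorem young_elem_decomposition:
  obtains \<beta> y where "y \<in> tensor.span (young_elem ` Collect leftward :: ('a, 'k::field_char_0) group_algebra set)"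
    and "young_elem id = pm_scale \<beta> core_product + y"
proof -
  let ?S = "tensor.span (young_elem ` Collect leftward) :: ('a, 'k) group_algebra set"
  obtain b where b: "core_product - pm_scale b (young_elem id) \<in> ?S"
    using core_product_in_span[where ?'k = 'k] by (auto simp: tensor.span_breakdown_eq)
  have fun_add: "row_functional (x + y) = row_functional x + row_functional y"
    and fun_scale: "row_functional (pm_scale k x) = k * row_functional x"
    for x y :: "('a, 'k) group_algebra" and k
    by (simp_all add: row_functional_def lookup_add sum.distrib sum_distrib_left)
  have S0: "row_functional z = 0" if "z \<in> ?S" for z
    using that
  proof (induction rule: tensor.span_induct_alt)
    case base
    then show ?case by (simp add: row_functional_def)
  next
    case (step k x y)
    then show ?case by (auto simp: fun_add fun_scale row_functional_leftward)
  qed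
  have "b \<noteq> 0"
    using S0[OF b] row_functional_core_product_nonzero[where ?'k = 'k] by auto
  then have "young_elem id = pm_scale (inverse b) core_product +
      pm_scale (- inverse b) (core_product - pm_scale b (young_elem id))"
    by (simp add: tensor.scale_right_diff_distrib)
  moreover have "pm_scale (- inverse b) (core_product - pm_scale b (young_elem id)) \<in> ?S"
    using b by (rule tensor.span_scale)
  ultimately show ?thesis using that by blast
qed

end

section \<open>Transport to the generic tensor algebra\<close>

lemma card_diagram: "card (diagram lam) = sum_list lam"
proof -
  have "diagram lam = (SIGMA i:{1..length lam}. {1..part lam i})"
    by (auto simp: diagram_def part_def split: if_splits)
  then have "card (diagram lam) = (\<Sum>i\<in>{1..length lam}. part lam i)" by simp
  also have "\<dots> = (\<Sum>i\<in>{0..<length lam}. lam ! i)"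
    by (rule sum.reindex_bij_witness[of _ Suc "\<lambda>i. i - 1"]) (auto simp: part_def)
  finally show ?thesis by (simp add: sum_list_sum_nth)
qed

lemma bijections_inv_into:
  assumes "f \<in> bijections X Y"
  shows "x \<in> X \<Longrightarrow> inv_into X f (f x) = x" "y \<in> Y \<Longrightarrow> f (inv_into X f y) = y"
    and "y \<in> Y \<Longrightarrow> inv_into X f y \<in> X" "x \<in> X \<Longrightarrow> f x \<in> Y"
  using assms bij_betw_inv_into_left[of f X Y x] bij_betw_inv_into_right[of f X Y y]
    bij_betw_apply[OF bij_betw_inv_into, of f X Y y]
  by (auto simp: bijections_def)

lemma bijectionsI:
  assumes "bij_betw f X Y" shows "restrict f X \<in> bijections X Y"
  unfolding bijections_def using assms by (auto simp: bij_betw_restrict_eq dest: bij_betwE)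

lemma ga_act_single:
  "ga_act A (Poly_Mapping.single p x) (Poly_Mapping.single w 1) =
    Poly_Mapping.single (compose {1..card A} p w) x"
  by (simp add: ga_act_def tensor_map_def)

lemma ga_act_sum: "ga_act A (sum f I) z = (\<Sum>i\<in>I. ga_act A (f i) z)"
  by (simp add: ga_act_def lin_extend_sum)

locale nested_tableau =
  fixes lam mu :: "nat list" and A :: "'a set" and T :: "nat \<times> nat \<Rightarrow> 'a"
  assumes partitions: "is_partition lam" "is_partition mu"
    and mu_sub: "diagram mu \<subseteq> diagram lam"
    and T: "T \<in> tableaux lam A"
begin

abbreviation "box_of \<equiv> inv_into (diagram lam) T"
abbreviation "row_of a \<equiv> fst (box_of a)"
abbreviation "col_of a \<equiv> snd (box_of a)"

sublocale nested_diagrams lam mu A row_of col_of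
  using partitions mu_sub T by unfold_locales (auto simp: bijections_def bij_betw_inv_into)

lemma A0_eq: "A0 = T ` diagram mu"
proof (intro equalityI subsetI)
  fix a assume "a \<in> A0"
  then show "a \<in> T ` diagram mu"
    using bijections_inv_into(2)[OF T, of a] by (auto simp: A0_def intro!: image_eqI[of _ _ "box_of a"])
next
  fix a assume "a \<in> T ` diagram mu"
  then obtain b where "b \<in> diagram mu" "a = T b" by blast
  then show "a \<in> A0"
    using mu_sub bijections_inv_into(1,4)[OF T, of b] by (auto simp: A0_def)
qed

text \<open>Stated for any \<open>nu\<close> inside \<open>lam\<close> to cover both
  \<open>T\<close> and its restriction \<open>S\<close>; rows and columns of \<open>S\<close> are
  read off from \<open>T\<close>, which places the inner groups inside the outer ones.\<close>

lemma young_symmetrizer_eq: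
  assumes nu: "is_partition nu" "diagram nu \<subseteq> diagram lam"
  shows "young_symmetrizer nu (restrict T (diagram nu)) =
    (\<Sum>p\<in>fiber_perms row_of (T ` diagram nu). \<Sum>t\<in>fiber_perms col_of (T ` diagram nu).
       Poly_Mapping.single (p \<circ> t) (of_int (sign t) :: 'k::field))"
proof -
  let ?B = "T ` diagram nu" and ?U = "restrict T (diagram nu)"
  have inv: "box_of (T b) = b" if "b \<in> diagram nu" for b
    using that nu(2) bijections_inv_into(1)[OF T, of b] by auto
  have rows: "tab_row nu ?U i = {a \<in> ?B. row_of a = i}" for i
    unfolding tab_row_def using inv by force
  have cols: "tab_col nu ?U j = {a \<in> ?B. col_of a = j}" for j
    unfolding tab_col_def using inv by force
  have rng: "fst b \<in> set [1..<length nu + 1]" "snd b \<in> set [1..<part nu 1 + 1]" if "b \<in> diagram nu" for b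
    using that part_antimono[OF nu(1), of 1 "fst b"]
    by (auto simp: diagram_def part_def simp del: upt_Suc split: if_splits)
  have all_rows: "{a \<in> ?B. row_of a \<in> set [1..<length nu + 1]} = ?B"
    and all_cols: "{a \<in> ?B. col_of a \<in> set [1..<part nu 1 + 1]} = ?B"
    using rng inv by (auto simp del: upt_Suc set_upt)
  have fin: "finite ?B" by simp
  have R: "ga_prod_list (map (\<lambda>i. symmetrizer (tab_row nu ?U i)) [1..<length nu + 1]) =
     (\<Sum>p\<in>fiber_perms row_of ?B. Poly_Mapping.single p (1::'k))"
    using ga_prod_list_fibers[OF fin, of "[1..<length nu + 1]" "\<lambda>_. 1::'k" row_of]
    unfolding symmetrizer_def rows all_rows by simp
  have C: "ga_prod_list (map (\<lambda>j. antisymmetrizer (tab_col nu ?U j)) [1..<part nu 1 + 1]) =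
     (\<Sum>t\<in>fiber_perms col_of ?B. Poly_Mapping.single t (of_int (sign t) :: 'k))"
    using ga_prod_list_fibers[OF fin, of "[1..<part nu 1 + 1]" "\<lambda>t. of_int (sign t) :: 'k" col_of]
    unfolding antisymmetrizer_def cols all_cols by (simp add: sign_compose_permutes[OF fin])
  show ?thesis unfolding young_symmetrizer_def R C ga_mult_sum_single by simp
qed

lemma tabloid_elem_eq:
  assumes nu: "is_partition nu" "diagram nu \<subseteq> diagram lam"
  shows "tabloid_elem nu G B (restrict T (diagram nu)) =
    (\<Sum>p\<in>fiber_perms row_of (T ` diagram nu). \<Sum>t\<in>fiber_perms col_of (T ` diagram nu).
       Poly_Mapping.single (compose {1..card B} (p \<circ> t)
         (compose {1..card B} (restrict T (diagram nu)) (inv_into (diagram nu) G))) (of_int (sign t) :: 'k::field))"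
  unfolding tabloid_elem_def young_symmetrizer_eq[OF nu] by (simp add: ga_act_sum ga_act_single)

text \<open>The factor \<open>h\<close> is absorbed into the word: c(T) h acts on \<open>w\<close>
  as c(T) acts on the word of \<open>T\<close> read in the order given by \<open>G\<close>.\<close>

lemma ga_act_young_elem:
  assumes "\<And>i. i \<in> {1..card A} \<Longrightarrow> h (w i) = T (inv_into (diagram lam) G i)"
  shows "ga_act A (young_elem h) (Poly_Mapping.single w 1) =
    (tabloid_elem lam G A T :: ('a, 'k::field) tensor)"
proof -
  have "T \<in> extensional (diagram lam)" using T by (auto simp: bijections_def PiE_def)
  then have TT: "restrict T (diagram lam) = T" by (rule extensional_restrict)
  have TA: "T ` diagram lam = A" using T by (simp add: bijections_def bij_betw_def)
  have "compose {1..card A} (p \<circ> t \<circ> h) w =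
      compose {1..card A} (p \<circ> t) (compose {1..card A} T (inv_into (diagram lam) G))" for p t :: "'a \<Rightarrow> 'a"
    using assms by (auto simp: compose_def fun_eq_iff)
  then show ?thesis
    using tabloid_elem_eq[OF partitions(1) order_refl, of G A, where ?'k = 'k]
    by (simp add: TT TA young_elem_def ga_act_sum ga_act_single)
qed

end

text \<open>A function of \<open>F\<close>, because the decomposition is later repeated with members
  of this set in place of \<open>F\<close>.\<close>

definition left_tableaux :: "nat list \<Rightarrow> nat \<Rightarrow> nat \<Rightarrow> (nat \<times> nat \<Rightarrow> nat) \<Rightarrow> (nat \<times> nat \<Rightarrow> nat) set" where
  "left_tableaux lam n k F = {G \<in> tableaux lam {1..n}.
           (\<forall>i\<in>{1..k}. inv_into (diagram lam) G i \<preceq> inv_into (diagram lam) F i) \<and>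
           (\<exists>i\<in>{1..k}. inv_into (diagram lam) G i \<prec> inv_into (diagram lam) F i) \<and>
           (\<exists>\<delta>. is_partition \<delta> \<and> diagram \<delta> \<subseteq> diagram lam \<and>
                G -` {1..k} \<inter> diagram lam = diagram \<delta>)}"

lemma is_ideal_subspace: "is_ideal I \<Longrightarrow> finite A \<Longrightarrow> tensor.subspace (I A)"
  by (simp add: is_ideal_def)

lemma is_ideal_map:
  "is_ideal I \<Longrightarrow> finite A \<Longrightarrow> finite B \<Longrightarrow> bij_betw \<phi> A B \<Longrightarrow> x \<in> I A \<Longrightarrow> tensor_map A \<phi> x \<in> I B"
  by (simp add: is_ideal_def)

lemma is_ideal_mult:
  "is_ideal I \<Longrightarrow> finite A \<Longrightarrow> finite B \<Longrightarrow> A \<inter> B = {} \<Longrightarrow> x \<in> I A \<Longrightarrow> y \<in> tensors B \<Longrightarrow>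
    tensor_mult A B x y \<in> I (A \<union> B)"
  by (simp add: is_ideal_def)

text \<open>A permutation fixing all letters after position \<open>k\<close> acts on the word by
  acting on its prefix and appending the unchanged tail.\<close>

lemma concat_bij_compose:
  assumes k: "k \<le> n" and w: "\<And>i. i \<in> {k<..n} \<Longrightarrow> p (w i) = w i"
  shows "concat_bij k (n - k) (compose {1..k} p w) (\<lambda>i\<in>{1..n - k}. w (i + k)) = compose {1..n} p w"
  using assms by (auto simp: concat_bij_def compose_def fun_eq_iff)

section \<open>The word of a labelled tableau and its membership in the ideals\<close>

locale labelled_nested_tableau = nested_tableau +
  fixes n k :: nat and F :: "nat \<times> nat \<Rightarrow> nat"
  assumes card_A: "card A = n" and k_le: "k \<le> n"
    and F: "F \<in> tableaux lam {1..n}" and F_mu: "F -` {1..k} \<inter> diagram lam = diagram mu"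
begin

definition word :: "nat \<Rightarrow> 'a" where "word = compose {1..n} T (inv_into (diagram lam) F)"

lemma word_apply: "i \<in> {1..n} \<Longrightarrow> word i = T (inv_into (diagram lam) F i)"
  by (simp add: word_def compose_def)

lemma bij_word: "bij_betw word {1..n} A"
proof -
  have "bij_betw (compose {1..n} T (inv_into (diagram lam) F)) {1..n} A"
    using F T by (intro bij_betw_compose[of _ _ "diagram lam"]) (auto simp: bijections_def bij_betw_inv_into)
  then show ?thesis by (simp add: word_def)
qed

lemma inv_F_mu: "i \<in> {1..n} \<Longrightarrow> inv_into (diagram lam) F i \<in> diagram mu \<longleftrightarrow> i \<le> k"
proof -
  assume i: "i \<in> {1..n}"
  have "inv_into (diagram lam) F i \<in> diagram mu \<longleftrightarrow>
      inv_into (diagram lam) F i \<in> F -` {1..k} \<inter> diagram lam"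
    by (simp only: F_mu)
  then show ?thesis using bijections_inv_into(2,3)[OF F i] i by simp
qed

text \<open>Since \<open>F\<close> fills the inner diagram with the numbers up to \<open>k\<close>,
  the prefix of length \<open>k\<close> consists exactly of the entries of \<open>S\<close>.\<close>

lemma word_core: "i \<in> {1..n} \<Longrightarrow> word i \<in> A0 \<longleftrightarrow> i \<le> k"
  using inv_F_mu[of i] bijections_inv_into(1,4)[OF T] bijections_inv_into(3)[OF F, of i]
  by (simp add: word_apply A0_def)

lemma card_A0: "card A0 = k"
proof -
  have "A0 = word ` {1..k}"
    using word_core bij_word k_le A0_subset by (auto simp: bij_betw_def)
  moreover have "inj_on word {1..k}"
    by (rule inj_on_subset[OF bij_betw_imp_inj_on[OF bij_word]]) (use k_le in auto)
  ultimately show ?thesis by (simp add: card_image)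
qed

lemma sum_list_mu: "sum_list mu = k"
proof -
  have "inj_on T (diagram mu)"
    using T mu_sub by (auto simp: bijections_def bij_betw_def intro: inj_on_subset)
  then show ?thesis using card_A0 by (simp add: A0_eq card_image card_diagram)
qed

lemma restrict_F_bij: "restrict F (diagram mu) \<in> tableaux mu {1..k}"
proof (rule bijectionsI)
  have "F ` diagram mu = {1..k}"
  proof (intro equalityI subsetI)
    fix i assume i: "i \<in> {1..k}"
    then have "inv_into (diagram lam) F i \<in> diagram mu" using k_le by (subst inv_F_mu) auto
    then have "F (inv_into (diagram lam) F i) \<in> F ` diagram mu" by (rule imageI)
    then show "i \<in> F ` diagram mu"
      using i k_le bijections_inv_into(2)[OF F, of i] by simp
  qed (use F_mu in blast)
  then show "bij_betw F (diagram mu) {1..k}"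
    using F mu_sub by (auto simp: bijections_def bij_betw_def intro: inj_on_subset)
qed

lemma inv_restrict_F:
  assumes "i \<in> {1..k}"
  shows "inv_into (diagram mu) (restrict F (diagram mu)) i = inv_into (diagram lam) F i"
proof (rule inv_into_f_eq)
  show "inj_on (restrict F (diagram mu)) (diagram mu)"
    using restrict_F_bij by (simp add: bijections_def bij_betw_def)
  show "inv_into (diagram lam) F i \<in> diagram mu" using assms k_le by (subst inv_F_mu) auto
  then show "restrict F (diagram mu) (inv_into (diagram lam) F i) = i"
    using bijections_inv_into(2)[OF F, of i] assms k_le by simp
qed

text \<open>Applying c(S) to the word gives an element of the inner tabloid times the tail, which
  lies in \<open>I\<close>. Multiplication by c(T) is then a combination of maps induced by
  bijections of \<open>A\<close>.\<close>

lemma core_product_act: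
  assumes I: "is_ideal I" "\<And>B. finite B \<Longrightarrow> young_tabloid mu (restrict F (diagram mu)) B \<subseteq> I B"
  shows "ga_act A core_product (Poly_Mapping.single word 1) \<in> (I A :: ('a, 'k::field) tensor set)"
proof -
  let ?T0 = "restrict T (diagram mu)" and ?F0 = "restrict F (diagram mu)"
  let ?tail = "\<lambda>i\<in>{1..n - k}. word (i + k)"
  let ?e = "tabloid_elem mu ?F0 A0 ?T0 :: ('a, 'k) tensor"
  let ?X = "tensor_mult A0 (A - A0) ?e (Poly_Mapping.single ?tail 1)"
  have cardB: "card (A - A0) = n - k"
    using A0_subset by (simp add: card_Diff_subset card_A card_A0)
  have "bij_betw T (diagram mu) A0"
    using T mu_sub by (auto simp: A0_eq bijections_def bij_betw_def intro: inj_on_subset)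
  then have "?T0 \<in> tableaux mu A0" by (rule bijectionsI)
  then have "?e \<in> young_tabloid mu ?F0 A0"
    by (auto simp: young_tabloid_def card_A0 sum_list_mu)
  then have eI: "?e \<in> I A0" by (rule subsetD[OF I(2)[OF finite_A0]])
  have "bij_betw (\<lambda>i. i + k) {1..n - k} {k<..n}"
    by (rule bij_betwI[where g = "\<lambda>i. i - k"]) (use k_le in auto)
  moreover have "bij_betw word {k<..n} (A - A0)"
  proof -
    have "word ` {k<..n} = A - A0"
      using bij_word word_core by (force simp: bij_betw_def)
    moreover have "inj_on word {k<..n}"
      by (rule inj_on_subset[OF bij_betw_imp_inj_on[OF bij_word]]) auto
    ultimately show ?thesis by (simp add: bij_betw_def)
  qed
  ultimately have "bij_betw (word \<circ> (\<lambda>i. i + k)) {1..n - k} (A - A0)" by (rule bij_betw_trans)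
  then have "?tail \<in> bijections {1..card (A - A0)} (A - A0)"
    unfolding cardB by (intro bijectionsI) (simp add: o_def)
  then have "Poly_Mapping.single ?tail 1 \<in> (tensors (A - A0) :: ('a, 'k) tensor set)"
    by (auto simp: tensors_def)
  then have "?X \<in> I (A0 \<union> (A - A0))"
    using eI by (intro is_ideal_mult[OF I(1)]) auto
  also have "A0 \<union> (A - A0) = A" using A0_subset by auto
  finally have XI: "?X \<in> I A" .
  have core_word: "compose {1..k} ?T0 (inv_into (diagram mu) ?F0) = restrict word {1..k}"
  proof (rule ext)
    fix i
    show "compose {1..k} ?T0 (inv_into (diagram mu) ?F0) i = restrict word {1..k} i"
      using inv_F_mu[of i] k_le by (auto simp: compose_def inv_restrict_F word_apply)
  qed
  have comp_restr: "compose {1..k} p (restrict word {1..k}) = compose {1..k} p word" for p :: "'a \<Rightarrow> 'a"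
    by (auto simp: compose_def)
  have e: "?e = (\<Sum>p\<in>row_group0. \<Sum>t\<in>col_group0.
       Poly_Mapping.single (compose {1..k} (p \<circ> t) word) (of_int (sign t)))"
    unfolding tabloid_elem_eq[OF partitions(2) mu_sub] card_A0 core_word comp_restr A0_eq[symmetric] ..
  have "?X = (\<Sum>p\<in>row_group0. \<Sum>t\<in>col_group0.
       Poly_Mapping.single (concat_bij k (n - k) (compose {1..k} (p \<circ> t) word) ?tail) (of_int (sign t)))"
    unfolding e tensor_mult_def by (simp add: lin_extend_sum card_A0 cardB)
  also have "\<dots> = (\<Sum>p\<in>row_group0. \<Sum>t\<in>col_group0.
       Poly_Mapping.single (compose {1..n} (p \<circ> t) word) (of_int (sign t)))"
  proof (intro sum.cong refl arg_cong2[of _ _ _ _ Poly_Mapping.single] concat_bij_compose k_le)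
    fix p t i assume pt: "p \<in> row_group0" "t \<in> col_group0" and "i \<in> {k<..n}"
    then have "word i \<notin> A0" using word_core[of i] by simp
    then show "(p \<circ> t) (word i) = word i"
      using pt[THEN fiber_perms_permutes] by (simp add: permutes_not_in)
  qed
  finally have X: "?X = (\<Sum>p\<in>row_group0. \<Sum>t\<in>col_group0.
       Poly_Mapping.single (compose {1..n} (p \<circ> t) word) (of_int (sign t)))" .
  have map: "tensor_map A q ?X = (\<Sum>p\<in>row_group0. \<Sum>t\<in>col_group0.
       Poly_Mapping.single (compose {1..n} (q \<circ> (p \<circ> t)) word) (of_int (sign t)))" for q
  proof -
    have "compose {1..n} q (compose {1..n} (p \<circ> t) word) = compose {1..n} (q \<circ> (p \<circ> t)) word" for p t :: "'a \<Rightarrow> 'a"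
      by (auto simp: compose_def)
    then show ?thesis unfolding X tensor_map_def card_A by (simp add: lin_extend_sum)
  qed
  have sub: "tensor.subspace (I A)" using I(1) finite_A by (rule is_ideal_subspace)
  have "ga_act A core_product (Poly_Mapping.single word 1) =
    (\<Sum>p'\<in>row_group0. \<Sum>t'\<in>col_group0. \<Sum>p\<in>row_group. \<Sum>t\<in>col_group.
      Poly_Mapping.single (compose {1..n} ((p \<circ> t) \<circ> (p' \<circ> t')) word) (of_int (sign t') * of_int (sign t) :: 'k))"
    unfolding core_product_def alt_elem_def young_elem_def
    by (simp add: ga_act_sum ga_act_single card_A tensor.scale_sum_right)
  also have "\<dots> = (\<Sum>p\<in>row_group. \<Sum>t\<in>col_group. pm_scale (of_int (sign t)) (tensor_map A (p \<circ> t) ?X))"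
  proof -
    have swap4: "(\<Sum>a\<in>P. \<Sum>b\<in>Q. \<Sum>c\<in>R. \<Sum>d\<in>S. f a b c d) = (\<Sum>c\<in>R. \<Sum>d\<in>S. \<Sum>a\<in>P. \<Sum>b\<in>Q. f a b c d)"
      for f :: "('a \<Rightarrow> 'a) \<Rightarrow> ('a \<Rightarrow> 'a) \<Rightarrow> ('a \<Rightarrow> 'a) \<Rightarrow> ('a \<Rightarrow> 'a) \<Rightarrow> ('a, 'k) tensor" and P Q R S
      using sum.swap[of "\<lambda>x y. f (fst x) (snd x) (fst y) (snd y)" "R \<times> S" "P \<times> Q"]
      by (simp add: sum.cartesian_product')
    show ?thesis unfolding map by (subst swap4) (simp add: tensor.scale_sum_right mult.commute)
  qed
  also have "\<dots> \<in> I A"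
  proof (intro tensor.subspace_sum tensor.subspace_scale sub)
    fix p t assume "p \<in> row_group" "t \<in> col_group"
    then have "bij_betw (p \<circ> t) A A"
      by (intro permutes_imp_bij permutes_compose) (auto dest: fiber_perms_permutes)
    then show "tensor_map A (p \<circ> t) ?X \<in> I A"
      using XI by (intro is_ideal_map[OF I(1)]) auto
  qed
  finally show ?thesis .
qed

lemma leftward_tabloid:
  assumes h: "leftward h"
  shows "\<exists>G\<in>left_tableaux lam n k F.
    ga_act A (young_elem h) (Poly_Mapping.single word 1) = (tabloid_elem lam G A T :: ('a, 'k::field) tensor)"
proof -
  let ?D = "diagram lam"
  have hA: "h permutes A" using h by (simp add: leftward_def)
  \<comment> \<open>\<open>F\<close> transported along \<open>h\<close>: the number \<open>i\<close>
    moves from the box of \<open>word i\<close> to the box of \<open>h (word i)\<close>. Conditions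
    on \<open>h\<close> over \<open>A0\<close> thus become conditions on the numbers up to
    \<open>k\<close>.\<close>
  define G0 where "G0 b = F (box_of (inv h (T b)))" for b
  define G where "G = restrict G0 ?D"
  have "bij_betw T ?D A" "bij_betw box_of A ?D" "bij_betw F ?D {1..n}" "bij_betw (inv h) A A"
    using T F hA by (auto simp: bijections_def bij_betw_inv_into intro: permutes_imp_bij permutes_inv)
  then have "bij_betw (F \<circ> (box_of \<circ> (inv h \<circ> T))) ?D {1..n}" by (meson bij_betw_trans)
  then have "bij_betw G0 ?D {1..n}" by (simp add: G0_def[abs_def] o_def)
  then have G: "G \<in> tableaux lam {1..n}" unfolding G_def by (rule bijectionsI)
  have hw: "h (word i) \<in> A" if "i \<in> {1..n}" for i
    using bij_word that by (auto simp: permutes_in_image[OF hA] bij_betw_def)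
  have invG: "inv_into ?D G i = box_of (h (word i))" if i: "i \<in> {1..n}" for i
  proof (rule inv_into_f_eq)
    show "inj_on G ?D" using G by (simp add: bijections_def bij_betw_def)
    show "box_of (h (word i)) \<in> ?D" using hw[OF i] bijections_inv_into(3)[OF T] by blast
    then show "G (box_of (h (word i))) = i"
      using hw[OF i] i bijections_inv_into[OF F] bijections_inv_into[OF T]
      by (simp add: G_def G0_def word_apply permutes_inverses[OF hA])
  qed
  have boxw: "box_of (word i) = inv_into ?D F i" if "i \<in> {1..n}" for i
    using that bijections_inv_into(3)[OF F] bijections_inv_into(1)[OF T] by (simp add: word_apply)
  have le: "inv_into ?D G i \<preceq> inv_into ?D F i" if "i \<in> {1..k}" for i
    using h that k_le word_core[of i] by (simp add: box_le_def invG leftward_def flip: boxw)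
  obtain a where a: "a \<in> A0" "col_of (h a) < col_of a" using h by (auto simp: leftward_def)
  obtain i where i: "i \<in> {1..n}" "a = word i"
    using a(1) A0_subset bij_word by (auto simp: bij_betw_def)
  have less: "\<exists>i\<in>{1..k}. inv_into ?D G i \<prec> inv_into ?D F i"
    using a i word_core[of i] by (intro bexI[of _ i]) (auto simp: box_less_def invG simp flip: boxw)
  obtain \<delta> where \<delta>: "is_partition \<delta>" "box_of ` h ` A0 = diagram \<delta>"
    using h by (auto simp: leftward_def)
  have hA0: "h ` A0 \<subseteq> A" using A0_subset permutes_image[OF hA] by auto
  have "diagram \<delta> \<subseteq> ?D" unfolding \<delta>(2)[symmetric] using hA0 bijections_inv_into(3)[OF T] by blast
  moreover have "G -` {1..k} \<inter> ?D = diagram \<delta>"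
  proof (intro equalityI subsetI)
    fix b assume "b \<in> diagram \<delta>"
    then obtain s where s: "s \<in> A0" "b = box_of (h s)" unfolding \<delta>(2)[symmetric] by auto
    then obtain i where i: "i \<in> {1..n}" "s = word i"
      using A0_subset bij_word by (auto simp: bij_betw_def)
    have "i \<le> k" using s i word_core by simp
    moreover have "b = inv_into ?D G i" using i s invG by simp
    ultimately show "b \<in> G -` {1..k} \<inter> ?D"
      using bijections_inv_into(2,3)[OF G i(1)] i by simp
  next
    fix b assume b: "b \<in> G -` {1..k} \<inter> ?D"
    then have i: "G b \<in> {1..n}" "G b \<le> k" using k_le by auto
    have "b = inv_into ?D G (G b)" using bijections_inv_into(1)[OF G] b by simp
    also have "\<dots> = box_of (h (word (G b)))" using invG i by simp
    finally show "b \<in> diagram \<delta>" unfolding \<delta>(2)[symmetric] using word_core i by blast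
  qed
  ultimately have "G \<in> left_tableaux lam n k F"
    unfolding left_tableaux_def using G le less \<delta>(1) by blast
  moreover have "ga_act A (young_elem h) (Poly_Mapping.single word 1) = (tabloid_elem lam G A T :: ('a, 'k) tensor)"
  proof (rule ga_act_young_elem)
    fix i assume "i \<in> {1..card A}"
    then show "h (word i) = T (inv_into ?D G i)"
      using hw invG bijections_inv_into(2)[OF T] by (simp add: card_A)
  qed
  ultimately show ?thesis by blast
qed

text \<open>Let the decomposition of c(T) act on the word: the core product lands in the ideal of
  the inner tabloid, and each leftward term is an element of the tabloid of a left tableau.\<close>

lemma tabloid_elem_in_ideal_sum:
  assumes "sum_list lam = n"
  shows "(tabloid_elem lam F A T :: ('a, 'k::field_char_0) tensor) \<in>
    ideal_sum (ideal_gen (young_tabloid mu (restrict F (diagram mu))))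
      (ideal_gen (\<lambda>B. \<Union>G\<in>left_tableaux lam n k F. young_tabloid lam G B)) A"
proof -
  let ?z = "Poly_Mapping.single word 1 :: ('a, 'k) tensor"
  obtain \<beta> y where y: "y \<in> tensor.span (young_elem ` Collect leftward :: ('a, 'k) group_algebra set)"
    and id: "young_elem id = pm_scale \<beta> core_product + y"
    by (rule young_elem_decomposition)
  have "tabloid_elem lam F A T = ga_act A (young_elem id) ?z"
    by (rule ga_act_young_elem[symmetric]) (simp add: word_apply card_A)
  also have "\<dots> = pm_scale \<beta> (ga_act A core_product ?z) + ga_act A y ?z"
    by (simp add: id ga_act_def lin_extend_add lin_extend_scale)
  finally have eq: "tabloid_elem lam F A T = pm_scale \<beta> (ga_act A core_product ?z) + ga_act A y ?z" .
  have 1: "pm_scale \<beta> (ga_act A core_product ?z) \<in> ideal_gen (young_tabloid mu (restrict F (diagram mu))) A"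
    unfolding ideal_gen_def
  proof clarify
    fix I :: "'a set \<Rightarrow> ('a, 'k) tensor set"
    assume I: "is_ideal I" "\<forall>B. finite B \<longrightarrow> young_tabloid mu (restrict F (diagram mu)) B \<subseteq> I B"
    then show "pm_scale \<beta> (ga_act A core_product ?z) \<in> I A"
      using core_product_act[of I] by (intro tensor.subspace_scale is_ideal_subspace) auto
  qed
  have 2: "ga_act A y ?z \<in> ideal_gen (\<lambda>B. \<Union>G\<in>left_tableaux lam n k F. young_tabloid lam G B) A"
    unfolding ideal_gen_def
  proof clarify
    fix I :: "'a set \<Rightarrow> ('a, 'k) tensor set"
    assume I: "is_ideal I" "\<forall>B. finite B \<longrightarrow> (\<Union>G\<in>left_tableaux lam n k F. young_tabloid lam G B) \<subseteq> I B"
    have mem: "tabloid_elem lam G A T \<in> I A" if "G \<in> left_tableaux lam n k F" for G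
    proof -
      have "tabloid_elem lam G A T \<in> (young_tabloid lam G A :: ('a, 'k) tensor set)"
        using T assms by (auto simp: young_tabloid_def card_A)
      then show ?thesis using I(2) that finite_A by blast
    qed
    show "ga_act A y ?z \<in> I A"
      unfolding ga_act_def
    proof (rule lin_extend_in_subspace[OF y])
      show "tensor.subspace (I A)" using I(1) finite_A by (rule is_ideal_subspace)
      fix s :: "('a, 'k) group_algebra" assume "s \<in> young_elem ` Collect leftward"
      then obtain h where "leftward h" "s = young_elem h" by blast
      then show "lin_extend (\<lambda>p. tensor_map A p ?z) s \<in> I A"
        using leftward_tabloid[of h, where ?'k = 'k] mem unfolding ga_act_def by metis
    qed
  qed
  show ?thesis unfolding ideal_sum_def using eq 1 2 by blast
qed

end

lemma young_tabloid_subset_ideal_sum: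
  fixes F :: "nat \<times> nat \<Rightarrow> nat"
  assumes "k \<le> n" "partition_of lam n" "is_partition mu" "diagram mu \<subseteq> diagram lam"
    and "F \<in> tableaux lam {1..n}" "F -` {1..k} \<inter> diagram lam = diagram mu"
  shows "(young_tabloid lam F A :: ('a, 'k::field_char_0) tensor set) \<subseteq>
    ideal_sum (ideal_gen (young_tabloid mu (restrict F (diagram mu))))
      (ideal_gen (\<lambda>B. \<Union>G\<in>left_tableaux lam n k F. young_tabloid lam G B)) A"
proof
  fix x :: "('a, 'k) tensor"
  assume "x \<in> young_tabloid lam F A"
  then obtain T where x: "x = tabloid_elem lam F A T" "card A = sum_list lam" "T \<in> tableaux lam A"
    by (auto simp: young_tabloid_def)
  interpret labelled_nested_tableau lam mu A T n k F
    using assms x by unfold_locales (auto simp: partition_of_def)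
  show "x \<in> ideal_sum (ideal_gen (young_tabloid mu (restrict F (diagram mu))))
      (ideal_gen (\<lambda>B. \<Union>G\<in>left_tableaux lam n k F. young_tabloid lam G B)) A"
    using tabloid_elem_in_ideal_sum assms(2) x(1) by (simp add: partition_of_def)
qed

section \<open>Passing from full tabloids to restricted tabloids\<close>

lemma ideal_gen_subset:
  assumes "is_ideal J" "\<And>B. finite B \<Longrightarrow> S B \<subseteq> J B"
  shows "ideal_gen S A \<subseteq> J A"
  unfolding ideal_gen_def using assms by (intro Inf_lower) auto

text \<open>The hypothesis asks only that every ideal containing \<open>S'\<close> also contain
  \<open>S\<close>, which is the form in which the iteration delivers the restricted
  tabloids.\<close>

lemma ideal_gen_mono:
  assumes "\<And>J B. is_ideal J \<Longrightarrow> (\<And>B. finite B \<Longrightarrow> S' B \<subseteq> J B) \<Longrightarrow> finite B \<Longrightarrow> S B \<subseteq> J B"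
  shows "ideal_gen S A \<subseteq> ideal_gen S' A"
proof -
  have "ideal_gen S A \<subseteq> J A" if "is_ideal J" "\<forall>B. finite B \<longrightarrow> S' B \<subseteq> J B" for J
    using that assms[of J] by (intro ideal_gen_subset) auto
  then show ?thesis unfolding ideal_gen_def[of S'] by auto
qed

text \<open>Tableaux reached after several steps still belong to the set attached to the original
  \<open>F\<close>, so their restrictions are among the given generators.\<close>

lemma left_tableaux_trans:
  assumes "G \<in> left_tableaux lam n k F" "G' \<in> left_tableaux lam n k G"
  shows "G' \<in> left_tableaux lam n k F"
  using assms unfolding left_tableaux_def box_le_def box_less_def
  by (auto intro: order_trans) (meson atLeastAtMost_iff le_less_trans order_less_le_trans)

text \<open>Each step of the decomposition moves the columns of the first \<open>k\<close> labels strictly to the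
  left, so it can be iterated until only the restricted tabloids are left.\<close>

lemma young_tabloid_left_subset:
  fixes J :: "'a set \<Rightarrow> ('a, 'k::field_char_0) tensor set"
  assumes k: "k \<le> n" and lam: "partition_of lam n" and J: "is_ideal J"
    and core: "\<And>G \<delta> B. G \<in> left_tableaux lam n k F \<Longrightarrow> is_partition \<delta> \<Longrightarrow>
      G -` {1..k} \<inter> diagram lam = diagram \<delta> \<Longrightarrow> finite B \<Longrightarrow>
      young_tabloid \<delta> (restrict G (diagram \<delta>)) B \<subseteq> J B"
    and G: "G \<in> left_tableaux lam n k F"
  shows "finite A \<Longrightarrow> young_tabloid lam G A \<subseteq> J A"
  using G
\<comment> \<open>The set \<open>A\<close> is generalized as well, since the generators belonging to
  the smaller tableaux live over all finite sets.\<close>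
proof (induction "\<Sum>i\<in>{1..k}. snd (inv_into (diagram lam) G i)" arbitrary: G A rule: less_induct)
  case less
  obtain \<delta> where \<delta>: "is_partition \<delta>" "diagram \<delta> \<subseteq> diagram lam" "G -` {1..k} \<inter> diagram lam = diagram \<delta>"
    and G: "G \<in> tableaux lam {1..n}"
    using less.prems(2) by (auto simp: left_tableaux_def)
  have "ideal_gen (young_tabloid \<delta> (restrict G (diagram \<delta>))) A \<subseteq> J A"
    using core[OF less.prems(2) \<delta>(1,3)] by (rule ideal_gen_subset[OF J])
  moreover have "ideal_gen (\<lambda>B. \<Union>G'\<in>left_tableaux lam n k G. young_tabloid lam G' B) A \<subseteq> J A"
  proof (rule ideal_gen_subset[OF J], rule UN_least)
    fix B :: "'a set" and G' assume B: "finite B" and G': "G' \<in> left_tableaux lam n k G"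
    have lt: "(\<Sum>i\<in>{1..k}. snd (inv_into (diagram lam) G' i)) < (\<Sum>i\<in>{1..k}. snd (inv_into (diagram lam) G i))"
      using G' by (intro sum_strict_mono_ex1) (auto simp: left_tableaux_def box_le_def box_less_def)
    show "young_tabloid lam G' B \<subseteq> J B"
      by (rule less.hyps[OF lt B left_tableaux_trans[OF less.prems(2) G']])
  qed
  ultimately have "ideal_sum (ideal_gen (young_tabloid \<delta> (restrict G (diagram \<delta>))))
      (ideal_gen (\<lambda>B. \<Union>G'\<in>left_tableaux lam n k G. young_tabloid lam G' B)) A \<subseteq> J A"
    using J less.prems(1) unfolding ideal_sum_def is_ideal_def by (auto intro!: tensor.subspace_add)
  then show ?case
    using young_tabloid_subset_ideal_sum[OF k lam \<delta>(1,2) G \<delta>(3), of A, where ?'k = 'k] by blast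
qed

theorem theorem3p2:
  fixes n k :: nat and lam \<mu> :: "nat list"
    and F :: "nat \<times> nat \<Rightarrow> nat" and \<G> :: "(nat \<times> nat \<Rightarrow> nat) set"
  assumes "1 \<le> k" and "k \<le> n"
    and "partition_of lam n" and "partition_of \<mu> k" and "diagram \<mu> \<subseteq> diagram lam"
    and "F \<in> tableaux lam {1..n}" and "F -` {1..k} \<inter> diagram lam = diagram \<mu>"
    and "\<G> = {G \<in> tableaux lam {1..n}.
           (\<forall>i\<in>{1..k}. inv_into (diagram lam) G i \<preceq> inv_into (diagram lam) F i) \<and>
           (\<exists>i\<in>{1..k}. inv_into (diagram lam) G i \<prec> inv_into (diagram lam) F i) \<and>
           (\<exists>\<delta>. is_partition \<delta> \<and> diagram \<delta> \<subseteq> diagram lam \<and>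
                G -` {1..k} \<inter> diagram lam = diagram \<delta>)}"
  shows "(\<forall>A :: 'a set. (young_tabloid lam F A :: ('a, 'k::field_char_0) tensor set) \<subseteq>
            ideal_sum (ideal_gen (young_tabloid \<mu> (restrict F (diagram \<mu>))))
                      (ideal_gen (\<lambda>B. \<Union>G\<in>\<G>. young_tabloid lam G B)) A) \<and>
         (\<forall>A :: 'a set. (young_tabloid lam F A :: ('a, 'k) tensor set) \<subseteq>
            ideal_sum (ideal_gen (young_tabloid \<mu> (restrict F (diagram \<mu>))))
                      (ideal_gen (\<lambda>B. \<Union>G\<in>\<G>. \<Union>\<delta>\<in>{\<delta>. is_partition \<delta> \<and>
                           G -` {1..k} \<inter> diagram lam = diagram \<delta>}.
                         young_tabloid \<delta> (restrict G (diagram \<delta>)) B)) A)"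
proof -
  let ?I0 = "ideal_gen (young_tabloid \<mu> (restrict F (diagram \<mu>))) :: 'a set \<Rightarrow> ('a, 'k) tensor set"
  let ?I1 = "ideal_gen (\<lambda>B. \<Union>G\<in>\<G>. young_tabloid lam G B) :: 'a set \<Rightarrow> ('a, 'k) tensor set"
  let ?S2 = "\<lambda>B. \<Union>G\<in>\<G>. \<Union>\<delta>\<in>{\<delta>. is_partition \<delta> \<and> G -` {1..k} \<inter> diagram lam = diagram \<delta>}.
    young_tabloid \<delta> (restrict G (diagram \<delta>)) B :: ('a, 'k) tensor set"
  have left: "\<G> = left_tableaux lam n k F" unfolding assms(8) left_tableaux_def ..
  have 1: "young_tabloid lam F A \<subseteq> ideal_sum ?I0 ?I1 A" for A
    unfolding left using assms by (intro young_tabloid_subset_ideal_sum) (auto simp: partition_of_def)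
  \<comment> \<open>An ideal containing the restricted tabloids contains the full ones by iteration,
    so the second inclusion follows from the first.\<close>
  have 2: "?I1 A \<subseteq> ideal_gen ?S2 A" for A
  proof (rule ideal_gen_mono, rule UN_least)
    fix J :: "'a set \<Rightarrow> ('a, 'k) tensor set" and B :: "'a set" and G
    assume J: "is_ideal J" "\<And>B. finite B \<Longrightarrow> ?S2 B \<subseteq> J B" and B: "finite B" and G: "G \<in> \<G>"
    show "young_tabloid lam G B \<subseteq> J B"
    proof (rule young_tabloid_left_subset[OF assms(2,3) J(1) _ G[unfolded left] B])
      fix G \<delta> and B :: "'a set"
      assume "G \<in> left_tableaux lam n k F" "is_partition \<delta>" "G -` {1..k} \<inter> diagram lam = diagram \<delta>" "finite B"
      then show "young_tabloid \<delta> (restrict G (diagram \<delta>)) B \<subseteq> J B"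
        using J(2)[of B] unfolding left by blast
    qed
  qed
  have "young_tabloid lam F A \<subseteq> ideal_sum ?I0 (ideal_gen ?S2) A" for A
    using 1[of A] 2[of A] unfolding ideal_sum_def by blast
  with 1 show ?thesis by blast
qed

end
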